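(* Let $\mathcal F$ be an algebraically closed and inversive difference field of characteristic zero, $\mathcal I\subset\mathcal F\{\mathbb Y^\pm\}$ a proper Laurent binomial difference ideal, and $L=\{\mathbf f\in\mathbb Z[x]^n\mid \exists c_{\mathbf f}\in\mathcal F^*,\ \mathbb Y^{\mathbf f}-c_{\mathbf f}\in\mathcal I\}$ the support lattice of $\mathcal I$. Then: (1) $\mathcal I$ is prime if and only if $L$ is $\mathbb Z$-saturated, that is, $k\mathbf f\in L$ implies $\mathbf f\in L$ for all integers $k\ge1$ and $\mathbf f\in\mathbb Z[x]^n$. (2) $\mathcal I$ is reflexive if and only if $L$ is $x$-saturated, that is, $x\mathbf f\in L$ implies $\mathbf f\in L$ for all $\mathbf f\in\mathbb Z[x]^n$. (3) If the well-mixed closure of $\mathcal I$ is not $[1]$, then $\mathcal I$ is well-mixed if and only if $L$ is M-saturated, that is, $k\mathbf f\in L$ implies $(x-o_k)\mathbf f\in L$ for all integers $k\ge1$ and $\mathbf f\in\mathbb Z[x]^n$, where $o_k$ is the $k$-th transforming degree of unity of $\mathcal F$. (4) If the perfect closure $\{\mathcal I\}$ of $\mathcal I$ is not $[1]$, then $\mathcal I$ is perfect if and only if $L$ is M-saturated and $x$-saturated.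
   Context: A difference field ($\sigma$-field) is a field $\mathcal F$ with a ring endomorphism $\sigma$ with $\sigma(a)=0$ iff $a=0$; it is inversive if $\sigma$ is bijective. $\mathcal F^*=\mathcal F\setminus\{0\}$. $\mathbb Y=\{y_1,\ldots,y_n\}$ are difference indeterminates. For $p=\sum_i c_ix^i\in\mathbb Z[x]$, $a^p:=\prod_i\sigma^i(a)^{c_i}$ (so $a^x=\sigma(a)$); for $\mathbf f\in\mathbb Z[x]^n$, $\mathbb Y^{\mathbf f}:=\prod_i y_i^{f_i}$. $\mathcal F\{\mathbb Y^{\pm}\}$ is the ring of Laurent difference polynomials (finite $\mathcal F$-linear combinations of the $\mathbb Y^{\mathbf f}$). A $\sigma$-ideal is an ideal closed under $\sigma$; $[S]$ is the $\sigma$-ideal generated by $S$; proper means $\neq[1]$. A Laurent binomial difference ideal is a $\sigma$-ideal generated by elements of the form $a\mathbb Y^{\mathbf g}+b\mathbb Y^{\mathbf h}$, $a,b\in\mathcal F$. $L$ is a $\mathbb Z[x]$-submodule of $\mathbb Z[x]^n$ (a $\mathbb Z[x]$-lattice). A $\sigma$-ideal $\mathcal I$ is: prime if it is a prime ideal; reflexive if $\sigma(a)\in\mathcal I$ implies $a\in\mathcal I$; well-mixed if $fg\in\mathcal I$ implies $f\sigma(g)\in\mathcal I$; perfect if for all $a\in\mathbb N[x]\setminus\{0\}$, $p^a\in\mathcal I$ implies $p\in\mathcal I$. The well-mixed (perfect) closure of $\mathcal I$ is the smallest well-mixed (perfect) $\sigma$-ideal containing $\mathcal I$. Transforming degree: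 for $k\ge2$ let $\zeta_k\in\mathcal F$ be the primitive $k$-th root of unity $e^{2\pi \mathrm i/k}$; $o_k\in\{0,\ldots,k-1\}$ is the number with $\sigma(\zeta_k)=\zeta_k^{o_k}$. Set $o_1=0$. *)

theory Defs
  imports
    "HOL-Library.Poly_Mapping"
    "HOL-Computational_Algebra.Polynomial"
    "HOL-Analysis.Finite_Cartesian_Product"
begin

section \<open>Difference fields\<close>

definition ring_endomorphism :: "('a::ring_1 \<Rightarrow> 'a) \<Rightarrow> bool" where
  "ring_endomorphism \<sigma> \<longleftrightarrow>
     \<sigma> 1 = 1 \<and> (\<forall>a b. \<sigma> (a + b) = \<sigma> a + \<sigma> b) \<and> (\<forall>a b. \<sigma> (a * b) = \<sigma> a * \<sigma> b)"

definition difference_field :: "('a::field \<Rightarrow> 'a) \<Rightarrow> bool" where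
  "difference_field \<sigma> \<longleftrightarrow> ring_endomorphism \<sigma> \<and> (\<forall>a. \<sigma> a = 0 \<longleftrightarrow> a = 0)"

definition inversive_difference_field :: "('a::field \<Rightarrow> 'a) \<Rightarrow> bool" where
  "inversive_difference_field \<sigma> \<longleftrightarrow> difference_field \<sigma> \<and> bij \<sigma>"


section \<open>Laurent difference polynomials\<close>

text \<open>
  The exponent vectors form the additive group of \<open>\<int>[x]\<^sup>n\<close>, where \<open>n = CARD('n)\<close>. The ring of
  Laurent difference polynomials is the group algebra of this group: the finitely supported
  function \<open>p\<close> stands for the sum of all \<open>lookup p f\<close> times \<open>Y\<close> to the power \<open>f\<close>, and the
  multiplication of \<^typ>\<open>'b \<Rightarrow>\<^sub>0 'a\<close> is convolution, so that the monomials with exponents \<open>f\<close>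
  and \<open>g\<close> multiply to the monomial with exponent \<open>f + g\<close>. The scalar multiplication of
  \<open>\<int>[x]\<close> on \<open>\<int>[x]\<^sup>n\<close> is \<open>*s\<close>, and \<open>[:0, 1:]\<close> is the polynomial \<open>x\<close>.
\<close>

type_synonym ('a, 'n) laurent = "(int poly ^ 'n) \<Rightarrow>\<^sub>0 'a"

abbreviation lterm :: "'a::zero \<Rightarrow> int poly ^ 'n \<Rightarrow> ('a, 'n) laurent" where
  "lterm a f \<equiv> Poly_Mapping.single f a"

abbreviation lmonom :: "int poly ^ 'n \<Rightarrow> ('a::zero_neq_one, 'n) laurent" where
  "lmonom f \<equiv> lterm 1 f"

abbreviation lconst :: "'a::zero \<Rightarrow> ('a, 'n::finite) laurent" where
  "lconst c \<equiv> lterm c 0"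

text \<open>The extension of \<open>\<sigma>\<close> which maps the monomial with exponent \<open>f\<close> to the one with exponent
  \<open>x f\<close>.\<close>

definition lsigma :: "('a::comm_ring_1 \<Rightarrow> 'a) \<Rightarrow> ('a, 'n::finite) laurent \<Rightarrow> ('a, 'n) laurent" where
  "lsigma \<sigma> p = (\<Sum>f\<in>Poly_Mapping.keys p. lterm (\<sigma> (Poly_Mapping.lookup p f)) ([:0, 1:] *s f))"

lemma lsigma_lterm:
  assumes "\<sigma> 0 = 0"
  shows "lsigma \<sigma> (lterm a f) = lterm (\<sigma> a) ([:0, 1:] *s f)"
  using assms by (simp add: lsigma_def)

text \<open>The power \<open>p\<^sup>a\<close>, the product of all \<open>s\<^sup>i(p)\<close> to the power \<open>a\<^sub>i\<close>, for \<open>a \<in> \<nat>[x]\<close>.\<close>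

definition diff_power :: "('r::comm_monoid_mult \<Rightarrow> 'r) \<Rightarrow> 'r \<Rightarrow> nat poly \<Rightarrow> 'r" where
  "diff_power s p a = (\<Prod>i\<le>degree a. ((s ^^ i) p) ^ coeff a i)"


section \<open>Difference ideals\<close>

definition ring_ideal :: "'r::comm_ring_1 set \<Rightarrow> bool" where
  "ring_ideal I \<longleftrightarrow>
     0 \<in> I \<and> (\<forall>p\<in>I. \<forall>q\<in>I. p + q \<in> I) \<and> (\<forall>r. \<forall>p\<in>I. r * p \<in> I)"

definition sigma_ideal :: "('r::comm_ring_1 \<Rightarrow> 'r) \<Rightarrow> 'r set \<Rightarrow> bool" where
  "sigma_ideal s I \<longleftrightarrow> ring_ideal I \<and> (\<forall>p\<in>I. s p \<in> I)"

definition sigma_ideal_gen :: "('r::comm_ring_1 \<Rightarrow> 'r) \<Rightarrow> 'r set \<Rightarrow> 'r set" where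
  "sigma_ideal_gen s S = sigma_ideal s hull S"

definition prime_ideal :: "'r::comm_ring_1 set \<Rightarrow> bool" where
  "prime_ideal I \<longleftrightarrow>
     ring_ideal I \<and> I \<noteq> UNIV \<and> (\<forall>p q. p * q \<in> I \<longrightarrow> p \<in> I \<or> q \<in> I)"

definition prime_sigma_ideal :: "('r::comm_ring_1 \<Rightarrow> 'r) \<Rightarrow> 'r set \<Rightarrow> bool" where
  "prime_sigma_ideal s I \<longleftrightarrow> sigma_ideal s I \<and> prime_ideal I"

definition reflexive_sigma_ideal :: "('r::comm_ring_1 \<Rightarrow> 'r) \<Rightarrow> 'r set \<Rightarrow> bool" where
  "reflexive_sigma_ideal s I \<longleftrightarrow> sigma_ideal s I \<and> (\<forall>p. s p \<in> I \<longrightarrow> p \<in> I)"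

definition well_mixed :: "('r::comm_ring_1 \<Rightarrow> 'r) \<Rightarrow> 'r set \<Rightarrow> bool" where
  "well_mixed s I \<longleftrightarrow> sigma_ideal s I \<and> (\<forall>p q. p * q \<in> I \<longrightarrow> p * s q \<in> I)"

definition perfect :: "('r::comm_ring_1 \<Rightarrow> 'r) \<Rightarrow> 'r set \<Rightarrow> bool" where
  "perfect s I \<longleftrightarrow>
     sigma_ideal s I \<and> (\<forall>a p. a \<noteq> 0 \<longrightarrow> diff_power s p a \<in> I \<longrightarrow> p \<in> I)"

definition well_mixed_closure :: "('r::comm_ring_1 \<Rightarrow> 'r) \<Rightarrow> 'r set \<Rightarrow> 'r set" where
  "well_mixed_closure s I = well_mixed s hull I"

definition perfect_closure :: "('r::comm_ring_1 \<Rightarrow> 'r) \<Rightarrow> 'r set \<Rightarrow> 'r set" where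
  "perfect_closure s I = perfect s hull I"

lemma sigma_ideal_sigma_ideal_gen: "sigma_ideal s (sigma_ideal_gen s S)"
  unfolding sigma_ideal_gen_def
  by (rule hull_in) (simp add: sigma_ideal_def ring_ideal_def)

lemma well_mixed_well_mixed_closure: "well_mixed s (well_mixed_closure s I)"
  unfolding well_mixed_closure_def
  by (rule hull_in) (simp add: well_mixed_def sigma_ideal_def ring_ideal_def)

lemma perfect_perfect_closure: "perfect s (perfect_closure s I)"
  unfolding perfect_closure_def
proof (rule hull_in)
  fix T assume T: "Ball T (perfect s)"
  then have "\<forall>J\<in>T. sigma_ideal s J" by (simp add: perfect_def)
  then have "sigma_ideal s (\<Inter>T)" by (simp add: sigma_ideal_def ring_ideal_def)
  moreover have "p \<in> \<Inter>T" if "a \<noteq> 0" "diff_power s p a \<in> \<Inter>T" for a p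
  proof
    fix J assume "J \<in> T"
    with T that have "perfect s J" "diff_power s p a \<in> J" by auto
    with \<open>a \<noteq> 0\<close> show "p \<in> J" unfolding perfect_def by blast
  qed
  ultimately show "perfect s (\<Inter>T)" unfolding perfect_def by blast
qed

lemma sigma_ideal_gen_1: "sigma_ideal_gen s {1} = UNIV"
proof -
  have "1 \<in> sigma_ideal_gen s {1}"
    using hull_subset[of "{1}" "sigma_ideal s"] by (simp add: sigma_ideal_gen_def)
  then have "r * 1 \<in> sigma_ideal_gen s {1}" for r
    using sigma_ideal_sigma_ideal_gen[of s "{1}"] by (simp only: sigma_ideal_def ring_ideal_def)
  then have "r \<in> sigma_ideal_gen s {1}" for r by (simp only: mult_1_right)
  then show ?thesis by blast
qed

definition laurent_binomial_ideal ::
    "('a::comm_ring_1 \<Rightarrow> 'a) \<Rightarrow> ('a, 'n::finite) laurent set \<Rightarrow> bool" where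
  "laurent_binomial_ideal \<sigma> I \<longleftrightarrow>
     (\<exists>S \<subseteq> {lterm a g + lterm b h | a b g h. True}. I = sigma_ideal_gen (lsigma \<sigma>) S)"


section \<open>Support lattices and saturation\<close>

definition support_lattice :: "('a::comm_ring_1, 'n::finite) laurent set \<Rightarrow> (int poly ^ 'n) set" where
  "support_lattice I = {f. \<exists>c. c \<noteq> 0 \<and> lmonom f - lconst c \<in> I}"

definition Z_saturated :: "(int poly ^ 'n) set \<Rightarrow> bool" where
  "Z_saturated L \<longleftrightarrow> (\<forall>k\<ge>1. \<forall>f. (of_nat k :: int poly) *s f \<in> L \<longrightarrow> f \<in> L)"

definition x_saturated :: "(int poly ^ 'n) set \<Rightarrow> bool" where
  "x_saturated L \<longleftrightarrow> (\<forall>f. [:0, 1:] *s f \<in> L \<longrightarrow> f \<in> L)"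

definition primitive_root_of_unity :: "nat \<Rightarrow> 'a::comm_ring_1 \<Rightarrow> bool" where
  "primitive_root_of_unity k z \<longleftrightarrow>
     0 < k \<and> z ^ k = 1 \<and> (\<forall>j. 0 < j \<and> j < k \<longrightarrow> z ^ j \<noteq> 1)"

text \<open>
  The element \<open>\<zeta> k\<close> plays the role of the primitive root of unity \<open>exp (2 \<pi> i / k)\<close>, which in an
  abstract field is only determined up to the choice of an embedding of the algebraic numbers.
\<close>

definition transforming_degree :: "('a::comm_ring_1 \<Rightarrow> 'a) \<Rightarrow> (nat \<Rightarrow> 'a) \<Rightarrow> nat \<Rightarrow> nat" where
  "transforming_degree \<sigma> \<zeta> k =
     (if k = 1 then 0 else (THE m. m < k \<and> \<sigma> (\<zeta> k) = \<zeta> k ^ m))"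

definition M_saturated ::
    "('a::comm_ring_1 \<Rightarrow> 'a) \<Rightarrow> (nat \<Rightarrow> 'a) \<Rightarrow> (int poly ^ 'n) set \<Rightarrow> bool" where
  "M_saturated \<sigma> \<zeta> L \<longleftrightarrow>
     (\<forall>k\<ge>1. \<forall>f. (of_nat k :: int poly) *s f \<in> L \<longrightarrow>
        ([:0, 1:] - of_nat (transforming_degree \<sigma> \<zeta> k)) *s f \<in> L)"

lemma transforming_degree_unique:
  fixes z :: "'a::field"
  assumes \<sigma>: "difference_field \<sigma>" and z: "primitive_root_of_unity k z"
  shows "\<exists>!m. m < k \<and> \<sigma> z = z ^ m"
proof -
  have k: "0 < k" and zk: "z ^ k = 1" and min: "\<And>j. 0 < j \<Longrightarrow> j < k \<Longrightarrow> z ^ j \<noteq> 1"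
    using z by (auto simp: primitive_root_of_unity_def)
  have z0: "z \<noteq> 0" using zk k by (auto simp: power_0_left)
  have ne: "z ^ i \<noteq> z ^ j" if "i < j" "j < k" for i j
  proof
    assume "z ^ i = z ^ j"
    moreover have "z ^ j = z ^ i * z ^ (j - i)" using that by (simp flip: power_add)
    ultimately have "z ^ (j - i) = 1" using z0 by simp
    then show False using min[of "j - i"] that by auto
  qed
  have inj: "inj_on (\<lambda>j. z ^ j) {..<k}"
    by (rule linorder_inj_onI) (use ne in auto)
  define P :: "'a poly" where "P = monom 1 k - 1"
  have cP: "coeff P k = 1" using k by (simp add: P_def coeff_1)
  then have P0: "P \<noteq> 0" by auto
  have dP: "degree P \<le> k" unfolding P_def by (intro degree_diff_le degree_monom_le) auto
  have roots: "{x. poly P x = 0} = {x. x ^ k = 1}" by (simp add: P_def poly_monom)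
  have fin: "finite {x::'a. x ^ k = 1}" using poly_roots_finite[OF P0] roots by simp
  have card: "card {x::'a. x ^ k = 1} \<le> k"
    using card_poly_roots_bound[OF P0] dP roots by simp
  have "(z ^ j) ^ k = 1" for j
  proof -
    have "(z ^ j) ^ k = z ^ (k * j)" by (simp only: mult.commute[of k j] power_mult)
    also have "\<dots> = 1" by (simp only: power_mult zk power_one)
    finally show ?thesis .
  qed
  then have sub: "(\<lambda>j. z ^ j) ` {..<k} \<subseteq> {x. x ^ k = 1}" by auto
  have eq: "(\<lambda>j. z ^ j) ` {..<k} = {x. x ^ k = 1}"
    using card_subset_eq[OF fin sub] card_mono[OF fin sub] card card_image[OF inj] by simp
  have pow: "\<sigma> (z ^ j) = \<sigma> z ^ j" for j
    using \<sigma> by (induction j) (auto simp: difference_field_def ring_endomorphism_def)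
  have "\<sigma> z ^ k = 1"
    using pow[of k] zk \<sigma> by (simp add: difference_field_def ring_endomorphism_def)
  then have "\<sigma> z \<in> (\<lambda>j. z ^ j) ` {..<k}" using eq by auto
  then obtain m where m: "m < k" "\<sigma> z = z ^ m" by auto
  show ?thesis
  proof (rule ex1I[of _ m])
    fix j assume "j < k \<and> \<sigma> z = z ^ j"
    with m show "j = m" by (intro inj_onD[OF inj]) auto
  qed (use m in simp)
qed

end

theory Submission
  imports Defs
begin

text \<open>
  Monomials are units in the ring of Laurent difference polynomials. A proper binomial difference
  ideal \<open>I\<close> is therefore determined by its support lattice \<open>L\<close> and by the character \<open>c\<close> of \<open>L\<close> for which
  \<open>I\<close> contains every \<open>Y\<^sup>f - c f\<close>: an element is in \<open>I\<close> exactly if, on each coset of \<open>L\<close>, its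
  coefficients weighted by \<open>c\<close> add up to \<open>0\<close> (\<open>lattice_ideal\<close>,
  \<open>laurent_binomial_ideal_eq_lattice_ideal\<close>). The quotient by \<open>I\<close> is a twisted group algebra of
  \<open>\<int>[x]\<^sup>n / L\<close>, and the properties of \<open>I\<close> are read off from this group.

  If \<open>L\<close> is \<open>\<int>\<close>-saturated, the group is torsion-free, so it can be ordered and leading terms show that
  there are no zero divisors (\<open>prime_lattice_ideal\<close>). Conversely, if \<open>k f \<in> L\<close>, then a multiple \<open>z\<close> of
  \<open>Y\<^sup>f\<close> satisfies \<open>z\<^sup>k = 1\<close> modulo \<open>I\<close>; a prime ideal contains one of the factors \<open>z - \<omega>\<^sup>j\<close> of
  \<open>z\<^sup>k - 1\<close>, and so \<open>f \<in> L\<close> (\<open>Z_saturated_support_lattice\<close>). If \<open>L\<close> is \<open>x\<close>-saturated, then \<open>\<sigma>\<close> maps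
  different cosets into different cosets, and \<open>\<sigma>(p)\<close> cannot vanish modulo \<open>I\<close> unless \<open>p\<close> does
  (\<open>reflexive_lattice_ideal\<close>).

  For the well-mixed property, the point is that \<open>z\<^sup>k = 1\<close> modulo a well-mixed ideal forces
  \<open>\<sigma>(z) = z\<^sup>e\<close> with \<open>e\<close> the transforming degree \<open>o\<^sub>k\<close>, because this holds on each component \<open>z = \<omega>\<^sup>j\<close>
  (\<open>well_mixed_root_of_unity\<close>). So well-mixed ideals have M-saturated support lattices. In the other
  direction, the same fact for the well-mixed closure, when that is proper, shows that every extension of \<open>c\<close>
  to the \<open>\<int>\<close>-saturation of an M-saturated \<open>L\<close> is automatically compatible with \<open>\<sigma>\<close>, and hence defines
  a prime difference ideal. There are enough such extensions to avoid any given \<open>r \<notin> I\<close>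
  (\<open>prime_sigma_ideal_avoiding\<close>): they come from ideals that are maximal among those avoiding \<open>r\<close>. Thus
  \<open>I\<close> is an intersection of prime difference ideals. Such an intersection is well-mixed, and it is
  perfect as soon as it is reflexive.
\<close>


section \<open>Ideals\<close>

lemma ring_ideal_diff:
  assumes "ring_ideal J" "p \<in> J" "q \<in> J"
  shows "p - q \<in> J"
proof -
  have "p + (-1) * q \<in> J" using assms unfolding ring_ideal_def by blast
  then show ?thesis by simp
qed

lemma ring_ideal_sum:
  assumes "ring_ideal J" "\<And>i. i \<in> A \<Longrightarrow> h i \<in> J"
  shows "sum h A \<in> J"
  using assms by (induction A rule: infinite_finite_induct) (auto simp: ring_ideal_def)

lemma ring_ideal_eq_UNIV_iff:
  assumes "ring_ideal J"
  shows "J = UNIV \<longleftrightarrow> 1 \<in> J"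
proof
  assume "1 \<in> J"
  then have "r * 1 \<in> J" for r using assms unfolding ring_ideal_def by blast
  then show "J = UNIV" by auto
qed simp

lemma ring_ideal_hull: "ring_ideal (ring_ideal hull S)"
  by (rule hull_in) (auto simp: ring_ideal_def)

text \<open>The ideal generated by \<open>J\<close> and one further element \<open>t\<close>.\<close>

lemma ring_ideal_adjoin:
  assumes "ring_ideal J"
  shows "ring_ideal {u + v * t | u v. u \<in> J}"
  unfolding ring_ideal_def
proof (intro conjI ballI allI)
  show "0 \<in> {u + v * t | u v. u \<in> J}"
    using assms by (auto simp: ring_ideal_def intro!: exI[of _ 0])
next
  fix p q assume "p \<in> {u + v * t | u v. u \<in> J}" "q \<in> {u + v * t | u v. u \<in> J}"
  then obtain u v u' v' where "p = u + v * t" "q = u' + v' * t" "u \<in> J" "u' \<in> J" by auto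
  then have "p + q = (u + u') + (v + v') * t" "u + u' \<in> J"
    using assms by (auto simp: algebra_simps ring_ideal_def)
  then show "p + q \<in> {u + v * t | u v. u \<in> J}" by blast
next
  fix r p assume "p \<in> {u + v * t | u v. u \<in> J}"
  then obtain u v where "p = u + v * t" "u \<in> J" by auto
  then have "r * p = r * u + (r * v) * t" "r * u \<in> J"
    using assms by (auto simp: algebra_simps ring_ideal_def)
  then show "r * p \<in> {u + v * t | u v. u \<in> J}" by blast
qed

text \<open>Zorn's lemma gives an ideal that is maximal among those that contain \<open>I\<close> and avoid \<open>r\<close>. The last
  conclusion is what maximality amounts to: adjoining any \<open>t \<notin> J\<close> brings in \<open>r\<close>, so \<open>r\<close> is a multiple
  of \<open>t\<close> modulo \<open>J\<close>.\<close>

lemma maximal_ideal_avoiding: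
  assumes I: "ring_ideal I" and r: "r \<notin> I"
  obtains J where "ring_ideal J" "I \<subseteq> J" "r \<notin> J" "\<forall>t. t \<notin> J \<longrightarrow> (\<exists>v. r - v * t \<in> J)"
proof -
  define \<A> where "\<A> = {J. ring_ideal J \<and> I \<subseteq> J \<and> r \<notin> J}"
  have "\<exists>M\<in>\<A>. \<forall>X\<in>\<A>. M \<subseteq> X \<longrightarrow> X = M"
  proof (rule subset_Zorn_nonempty)
    show "\<A> \<noteq> {}" using I r by (auto simp: \<A>_def)
  next
    fix \<C> assume ne: "\<C> \<noteq> {}" and ch: "subset.chain \<A> \<C>"
    have in_A: "J \<in> \<A>" if "J \<in> \<C>" for J
      using ch that by (auto simp: subset.chain_def)
    have tot: "J \<subseteq> J' \<or> J' \<subseteq> J" if "J \<in> \<C>" "J' \<in> \<C>" for J J'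
      using ch that by (auto simp: subset.chain_def)
    have "p + q \<in> \<Union>\<C>" if pq: "p \<in> \<Union>\<C>" "q \<in> \<Union>\<C>" for p q
    proof -
      obtain J J' where "J \<in> \<C>" "p \<in> J" "J' \<in> \<C>" "q \<in> J'" using pq by auto
      then obtain K where "K \<in> \<C>" "p \<in> K" "q \<in> K" using tot[of J J'] by blast
      then show ?thesis using in_A[of K] by (auto simp: \<A>_def ring_ideal_def)
    qed
    moreover have "s * p \<in> \<Union>\<C>" if "p \<in> \<Union>\<C>" for s p
      using that in_A unfolding \<A>_def ring_ideal_def by blast
    moreover have "0 \<in> \<Union>\<C>" "I \<subseteq> \<Union>\<C>"
      using ne in_A by (auto simp: \<A>_def ring_ideal_def)
    moreover have "r \<notin> \<Union>\<C>" using in_A by (auto simp: \<A>_def)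
    ultimately show "\<Union>\<C> \<in> \<A>" by (auto simp: \<A>_def ring_ideal_def)
  qed
  then obtain J where J: "ring_ideal J" "I \<subseteq> J" "r \<notin> J"
    and max: "\<And>X. ring_ideal X \<Longrightarrow> I \<subseteq> X \<Longrightarrow> r \<notin> X \<Longrightarrow> J \<subseteq> X \<Longrightarrow> X = J"
    by (auto simp: \<A>_def)
  have "\<exists>v. r - v * t \<in> J" if t: "t \<notin> J" for t
  proof -
    let ?X = "{u + v * t | u v. u \<in> J}"
    have "J \<subseteq> ?X" by (force intro: exI[of _ 0])
    moreover have "t \<in> ?X"
      using J(1) by (force simp: ring_ideal_def intro: exI[of _ 0] exI[of _ 1])
    ultimately have "r \<in> ?X"
      using max[OF ring_ideal_adjoin[OF J(1)], of t] J(2) t by blast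
    then obtain u v where "r = u + v * t" "u \<in> J" by auto
    then show ?thesis by (auto intro: exI[of _ v])
  qed
  then show ?thesis using that J by blast
qed


section \<open>Powers of a root of unity\<close>

text \<open>The quotient of \<open>z\<^sup>k - 1\<close> by \<open>z - \<omega>\<^sup>j\<close>, written out by the geometric sum. Modulo
  \<open>z\<^sup>k - 1\<close>, and for invertible \<open>k\<close>, these quotients are up to units the idempotents that split \<open>z\<^sup>k = 1\<close> into the components \<open>z = \<omega>\<^sup>j\<close>.\<close>

definition cofactor :: "'r::comm_ring_1 \<Rightarrow> 'r \<Rightarrow> nat \<Rightarrow> nat \<Rightarrow> 'r" where
  "cofactor z \<omega> k j = (\<Sum>i<k. (\<omega> ^ j) ^ (k - Suc i) * z ^ i)"

lemma diff_times_cofactor: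
  assumes "\<omega> ^ k = 1"
  shows "(z - \<omega> ^ j) * cofactor z \<omega> k j = z ^ k - 1"
proof -
  have "(\<omega> ^ j) ^ k = 1" using assms by (metis mult.commute power_mult power_one)
  then show ?thesis
    using power_diff_sumr2[of z k "\<omega> ^ j"] by (simp add: cofactor_def)
qed

text \<open>Collecting powers of \<open>z\<close>, the coefficient of \<open>z\<^sup>i\<close> is the sum over \<open>j\<close> of \<open>\<omega>\<close> to the power
  \<open>(k - i) j\<close>, which vanishes by orthogonality unless \<open>i = 0\<close>. The second assumption is orthogonality
  itself, since in a ring with zero divisors it does not follow from \<open>\<omega>\<close> having order \<open>k\<close>.\<close>

lemma sum_cofactors:
  assumes \<omega>: "\<omega> ^ k = 1" and orth: "\<And>m. 0 < m \<Longrightarrow> m < k \<Longrightarrow> (\<Sum>j<k. \<omega> ^ (m * j)) = 0"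
  shows "(\<Sum>j<k. \<omega> ^ j * cofactor z \<omega> k j) = of_nat k"
proof (cases "k = 0")
  case False
  have pow: "\<omega> ^ j * (\<omega> ^ j) ^ (k - Suc i) = \<omega> ^ ((k - i) * j)" if "i < k" for i j
  proof -
    have "Suc (k - Suc i) = k - i" using that by simp
    then have "\<omega> ^ j * (\<omega> ^ j) ^ (k - Suc i) = (\<omega> ^ j) ^ (k - i)" by (metis power_Suc)
    then show ?thesis by (simp add: power_mult[symmetric] mult.commute)
  qed
  have inner: "(\<Sum>j<k. \<omega> ^ ((k - i) * j)) = (if i = 0 then of_nat k else 0)" if "i < k" for i
    using that orth[of "k - i"] \<omega> by (auto simp: power_mult)
  have "(\<Sum>j<k. \<omega> ^ j * cofactor z \<omega> k j) = (\<Sum>j<k. \<Sum>i<k. \<omega> ^ ((k - i) * j) * z ^ i)"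
    by (simp add: cofactor_def sum_distrib_left mult.assoc[symmetric] pow)
  also have "\<dots> = (\<Sum>i<k. (\<Sum>j<k. \<omega> ^ ((k - i) * j)) * z ^ i)"
    by (subst sum.swap) (simp add: sum_distrib_right)
  also have "\<dots> = (\<Sum>i<k. if i = 0 then of_nat k else 0)"
    by (intro sum.cong) (auto simp: inner)
  also have "\<dots> = of_nat k" using False by simp
  finally show ?thesis .
qed (use assms in simp)

text \<open>Membership can be tested on the components: where \<open>k\<close> is invertible, the cofactors generate the
  unit ideal.\<close>

lemma of_nat_mult_in_ideal_if_cofactors:
  assumes J: "ring_ideal J"
    and "\<omega> ^ k = 1" "\<And>m. 0 < m \<Longrightarrow> m < k \<Longrightarrow> (\<Sum>j<k. \<omega> ^ (m * j)) = 0"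
    and q: "\<And>j. j < k \<Longrightarrow> q * cofactor z \<omega> k j \<in> J"
  shows "of_nat k * q \<in> J"
proof -
  have "of_nat k * q = (\<Sum>j<k. \<omega> ^ j * (q * cofactor z \<omega> k j))"
    using sum_cofactors[OF assms(2,3), of z, symmetric]
    by (simp add: sum_distrib_right sum_distrib_left mult_ac)
  also have "\<dots> \<in> J"
    using J q by (intro ring_ideal_sum) (auto simp: ring_ideal_def)
  finally show ?thesis .
qed

text \<open>On the component \<open>z = \<omega>\<^sup>j\<close> a well-mixed ideal allows \<open>s\<close> to be applied to the factor
  \<open>z - \<omega>\<^sup>j\<close>, so that \<open>s z\<close> becomes \<open>s (\<omega>\<^sup>j) = (\<omega>\<^sup>j)\<^sup>e\<close> there; but this is \<open>z\<^sup>e\<close>. As \<open>s z\<close> and \<open>z\<^sup>e\<close>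
  agree on every component, they agree modulo the ideal.\<close>

lemma well_mixed_root_of_unity:
  assumes wm: "well_mixed s J"
    and s: "\<And>p q. s (p - q) = s p - s q" "\<And>p n. s (p ^ n) = s p ^ n"
    and \<omega>: "\<omega> ^ k = 1" "\<And>m. 0 < m \<Longrightarrow> m < k \<Longrightarrow> (\<Sum>j<k. \<omega> ^ (m * j)) = 0"
    and s\<omega>: "s \<omega> = \<omega> ^ e" and z: "z ^ k - 1 \<in> J"
  shows "of_nat k * (s z - z ^ e) \<in> J"
proof (rule of_nat_mult_in_ideal_if_cofactors[OF _ \<omega>])
  show J: "ring_ideal J" using wm by (simp add: well_mixed_def sigma_ideal_def)
  fix j
  let ?c = "cofactor z \<omega> k j"
  have c: "?c * (z - \<omega> ^ j) \<in> J"
    using z diff_times_cofactor[OF \<omega>(1), of z j] by (simp add: mult.commute)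
  then have 1: "?c * s (z - \<omega> ^ j) \<in> J" using wm by (auto simp: well_mixed_def)
  have "z ^ e - (\<omega> ^ j) ^ e = (z - \<omega> ^ j) * (\<Sum>i<e. (\<omega> ^ j) ^ (e - Suc i) * z ^ i)"
    by (rule power_diff_sumr2)
  then have "?c * (z ^ e - (\<omega> ^ j) ^ e)
      = (\<Sum>i<e. (\<omega> ^ j) ^ (e - Suc i) * z ^ i) * (?c * (z - \<omega> ^ j))"
    by (simp add: mult_ac)
  then have 2: "?c * (z ^ e - (\<omega> ^ j) ^ e) \<in> J" using c J by (auto simp: ring_ideal_def)
  have "s (z - \<omega> ^ j) = s z - (\<omega> ^ j) ^ e"
    by (simp add: s s\<omega> power_mult[symmetric] mult.commute)
  then have "(s z - z ^ e) * ?c = ?c * s (z - \<omega> ^ j) - ?c * (z ^ e - (\<omega> ^ j) ^ e)"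
    by (simp only:) (simp add: algebra_simps)
  then show "(s z - z ^ e) * ?c \<in> J" using ring_ideal_diff[OF J 1 2] by simp
qed

lemma primitive_root_sum_powers:
  fixes w :: "'a::field"
  assumes "primitive_root_of_unity k w" "0 < m" "m < k"
  shows "(\<Sum>j<k. w ^ (m * j)) = 0"
proof -
  have "w ^ m \<noteq> 1" "w ^ k = 1" using assms by (auto simp: primitive_root_of_unity_def)
  moreover from this have "(w ^ m) ^ k = 1" by (metis mult.commute power_mult power_one)
  ultimately show ?thesis using geometric_sum[of "w ^ m" k] by (simp add: power_mult)
qed


section \<open>Group algebras\<close>

lemma poly_mapping_add_induct [case_names single add]:
  assumes single: "\<And>f a. P (Poly_Mapping.single f a)"
    and add: "\<And>p q. P p \<Longrightarrow> P q \<Longrightarrow> P (p + q)"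
  shows "P (p :: 'g \<Rightarrow>\<^sub>0 'a::comm_monoid_add)"
proof (induction p rule: update_induct)
  case const
  show ?case using single[of undefined 0] by simp
next
  case (update p f a)
  then have "Poly_Mapping.update f a p = Poly_Mapping.single f a + p"
    by (intro poly_mapping_eqI)
      (auto simp: lookup_update lookup_add lookup_single when_def not_in_keys_iff_lookup_eq_zero)
  then show ?case using update single add by metis
qed

text \<open>The \<open>'a\<close>-linear map on the group algebra with values \<open>\<phi>\<close> on the monomials.\<close>

definition linear_extension :: "('g \<Rightarrow> 'a::comm_ring_1) \<Rightarrow> ('g \<Rightarrow>\<^sub>0 'a) \<Rightarrow> 'a" where
  "linear_extension \<phi> p = (\<Sum>f\<in>Poly_Mapping.keys p. Poly_Mapping.lookup p f * \<phi> f)"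

lemma linear_extension_single [simp]:
  "linear_extension \<phi> (Poly_Mapping.single f a) = a * \<phi> f"
  by (simp add: linear_extension_def)

lemma linear_extension_0 [simp]: "linear_extension \<phi> 0 = 0"
  by (simp add: linear_extension_def)

lemma linear_extension_add [simp]:
  "linear_extension \<phi> (p + q) = linear_extension \<phi> p + linear_extension \<phi> q"
  unfolding linear_extension_def by (rule setsum_keys_plus_distrib) (auto simp: algebra_simps)

lemma linear_extension_diff [simp]:
  "linear_extension \<phi> (p - q) = linear_extension \<phi> p - linear_extension \<phi> q"
  using linear_extension_add[of \<phi> "p - q" q] by simp

lemma linear_extension_single_mult:
  fixes p :: "'g::ab_group_add \<Rightarrow>\<^sub>0 'a::comm_ring_1"
  shows "linear_extension \<phi> (Poly_Mapping.single h a * p) = a * linear_extension (\<lambda>f. \<phi> (h + f)) p"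
  by (induction p rule: poly_mapping_add_induct) (auto simp: mult_single algebra_simps)

lemma linear_extension_mult:
  fixes p q :: "'g::ab_group_add \<Rightarrow>\<^sub>0 'a::comm_ring_1"
  shows "linear_extension \<phi> (p * q) =
    (\<Sum>u\<in>Poly_Mapping.keys p. \<Sum>v\<in>Poly_Mapping.keys q.
       Poly_Mapping.lookup p u * Poly_Mapping.lookup q v * \<phi> (u + v))"
proof -
  have "linear_extension \<phi> (p * q) = linear_extension (\<lambda>u. linear_extension (\<lambda>v. \<phi> (u + v)) q) p"
    by (induction p rule: poly_mapping_add_induct)
      (auto simp: linear_extension_single_mult distrib_right)
  then show ?thesis by (simp add: linear_extension_def sum_distrib_left mult_ac)
qed


section \<open>Lattice ideals\<close>

text \<open>A character, with values in the units of a field, of the subgroup \<open>{m. c m \<noteq> 0}\<close>, extended by \<open>0\<close>.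
  Letting \<open>f\<close> range over the whole group in the product rule makes the support closed under addition
  and negation at once: for \<open>m\<close> in the support, \<open>m + f\<close> lies in it exactly if \<open>f\<close> does.\<close>

definition partial_character :: "('g::ab_group_add \<Rightarrow> 'a::field) \<Rightarrow> bool" where
  "partial_character c \<longleftrightarrow> c 0 = 1 \<and> (\<forall>m f. c m \<noteq> 0 \<longrightarrow> c (m + f) = c m * c f)"

lemma partial_character_0: "partial_character c \<Longrightarrow> c 0 = 1"
  by (simp add: partial_character_def)

lemma partial_character_add: "partial_character c \<Longrightarrow> c m \<noteq> 0 \<Longrightarrow> c (m + f) = c m * c f"
  by (simp add: partial_character_def)

lemma partial_character_minus:
  assumes c: "partial_character c"
  shows "c (- m) = inverse (c m)"
proof (cases "c m = 0")
  case False
  then have "c m * c (- m) = 1"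
    using partial_character_add[OF c False, of "- m"] partial_character_0[OF c] by simp
  then show ?thesis by (simp add: inverse_unique)
next
  case True
  have "c (- m) = 0"
  proof (rule ccontr)
    assume "c (- m) \<noteq> 0"
    then have "c (- m + m) = c (- m) * c m" by (rule partial_character_add[OF c])
    then show False using True partial_character_0[OF c] by simp
  qed
  then show ?thesis using True by simp
qed

text \<open>Modulo the binomials \<open>Y\<^sup>m - c m\<close> every monomial \<open>Y\<^sup>f\<close> equals \<open>c (f - g) Y\<^sup>g\<close> for each \<open>g\<close> in its
  coset of the support of \<open>c\<close>. The linear extension below thus collects on \<open>Y\<^sup>g\<close> all terms of \<open>p\<close> in
  the coset of \<open>g\<close>, and \<open>p\<close> is in the ideal if nothing is left on any coset. That these elements are
  those of the ideal generated by the binomials is shown below.\<close>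

definition lattice_ideal :: "('g::ab_group_add \<Rightarrow> 'a::field) \<Rightarrow> ('g \<Rightarrow>\<^sub>0 'a) set" where
  "lattice_ideal c = {p. \<forall>g. linear_extension (\<lambda>f. c (f - g)) p = 0}"

lemma ring_ideal_lattice_ideal: "ring_ideal (lattice_ideal c)"
proof -
  have "r * p \<in> lattice_ideal c" if p: "p \<in> lattice_ideal c" for r p
  proof (induction r rule: poly_mapping_add_induct)
    case (single h a)
    have "linear_extension (\<lambda>f. c (h + f - g)) p = 0" for g
    proof -
      have "h + f - g = f - (g - h)" for f by simp
      then show ?thesis using p by (simp only: lattice_ideal_def mem_Collect_eq)
    qed
    then show ?case by (simp add: lattice_ideal_def linear_extension_single_mult)
  qed (simp add: lattice_ideal_def distrib_right)
  then show ?thesis by (auto simp: ring_ideal_def lattice_ideal_def)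
qed

lemma binomial_in_lattice_ideal_iff:
  assumes c: "partial_character c" and a: "a \<noteq> 0"
  shows "Poly_Mapping.single f 1 - Poly_Mapping.single 0 a \<in> lattice_ideal c \<longleftrightarrow> c f = a"
proof
  assume *: "Poly_Mapping.single f 1 - Poly_Mapping.single 0 a \<in> lattice_ideal c"
  have **: "c (f - g) = a * c (- g)" for g using * by (simp add: lattice_ideal_def)
  from **[of 0] show "c f = a" using partial_character_0[OF c] by simp
next
  assume "c f = a"
  then have "c (f - g) = a * c (- g)" for g
    using partial_character_add[OF c, of f "- g"] a by simp
  then show "Poly_Mapping.single f 1 - Poly_Mapping.single 0 a \<in> lattice_ideal c"
    by (simp add: lattice_ideal_def)
qed

lemma one_notin_lattice_ideal:
  assumes c: "partial_character c"
  shows "1 \<notin> lattice_ideal c"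
proof
  assume "1 \<in> lattice_ideal c"
  then have "linear_extension (\<lambda>f. c (f - 0)) (Poly_Mapping.single 0 1) = 0"
    unfolding lattice_ideal_def by (simp only: single_one mem_Collect_eq)
  then show False using partial_character_0[OF c] by (simp del: single_one)
qed

definition lattice_binomials :: "('g::ab_group_add \<Rightarrow> 'a::field) \<Rightarrow> ('g \<Rightarrow>\<^sub>0 'a) set" where
  "lattice_binomials c = {Poly_Mapping.single f 1 - Poly_Mapping.single 0 (c f) | f. c f \<noteq> 0}"

text \<open>At most one term in each coset of the support of \<open>c\<close>: a normal form modulo the lattice ideal.\<close>

definition reduced :: "('g::ab_group_add \<Rightarrow> 'a::field) \<Rightarrow> ('g \<Rightarrow>\<^sub>0 'a) \<Rightarrow> bool" where
  "reduced c p \<longleftrightarrow>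
     (\<forall>u\<in>Poly_Mapping.keys p. \<forall>v\<in>Poly_Mapping.keys p. c (u - v) \<noteq> 0 \<longrightarrow> u = v)"

text \<open>Move every term to the chosen representative of its coset, using the binomials.\<close>

lemma reduce_mod_lattice:
  fixes c :: "'g::ab_group_add \<Rightarrow> 'a::field"
  assumes c: "partial_character c"
  obtains p' where "p - p' \<in> ring_ideal hull lattice_binomials c" "reduced c p'"
proof -
  \<comment> \<open>\<open>\<rho>\<close> chooses an element from each coset.\<close>
  define \<rho> where "\<rho> f = (SOME g. c (f - g) \<noteq> 0)" for f
  have c0: "c 0 = 1" by (rule partial_character_0[OF c])
  have \<rho>: "c (f - \<rho> f) \<noteq> 0" for f
    unfolding \<rho>_def by (rule someI[of _ f]) (simp add: c0)
  have trans: "c (f - h) \<noteq> 0" if "c (f - g) \<noteq> 0" "c (g - h) \<noteq> 0" for f g h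
    using partial_character_add[OF c that(1), of "g - h"] that by simp
  have sym: "c (g - f) \<noteq> 0" if "c (f - g) \<noteq> 0" for f g
    using partial_character_minus[OF c, of "f - g"] that by simp
  have \<rho>_eq: "\<rho> f = \<rho> g" if "c (f - g) \<noteq> 0" for f g
  proof -
    have "c (f - h) \<noteq> 0 \<longleftrightarrow> c (g - h) \<noteq> 0" for h using trans sym that by blast
    then show ?thesis by (simp add: \<rho>_def)
  qed
  let ?J = "ring_ideal hull lattice_binomials c"
  let ?p' = "\<Sum>f\<in>Poly_Mapping.keys p.
    Poly_Mapping.single (\<rho> f) (Poly_Mapping.lookup p f * c (f - \<rho> f))"
  have keys: "Poly_Mapping.keys ?p' \<subseteq> range \<rho>"
    by (rule order_trans[OF keys_sum]) (auto split: if_splits)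
  show ?thesis
  proof
    have "u = v"
      if "u \<in> Poly_Mapping.keys ?p'" "v \<in> Poly_Mapping.keys ?p'" and uv: "c (u - v) \<noteq> 0" for u v
    proof -
      from keys that obtain f g where fg: "u = \<rho> f" "v = \<rho> g" by blast
      then have "c (f - g) \<noteq> 0" using \<rho> sym trans uv by meson
      then show "u = v" using \<rho>_eq fg by simp
    qed
    then show "reduced c ?p'" by (simp add: reduced_def)
  next
    have "Poly_Mapping.single f a - Poly_Mapping.single (\<rho> f) (a * c (f - \<rho> f)) \<in> ?J" for f a
    proof -
      have "Poly_Mapping.single (f - \<rho> f) 1 - Poly_Mapping.single 0 (c (f - \<rho> f)) \<in> ?J"
        using \<rho> by (intro hull_inc) (auto simp: lattice_binomials_def)
      then have "Poly_Mapping.single (\<rho> f) a *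
          (Poly_Mapping.single (f - \<rho> f) 1 - Poly_Mapping.single 0 (c (f - \<rho> f))) \<in> ?J"
        using ring_ideal_hull[of "lattice_binomials c"] unfolding ring_ideal_def by blast
      then show ?thesis by (simp add: right_diff_distrib mult_single)
    qed
    then have "(\<Sum>f\<in>Poly_Mapping.keys p. Poly_Mapping.single f (Poly_Mapping.lookup p f) -
        Poly_Mapping.single (\<rho> f) (Poly_Mapping.lookup p f * c (f - \<rho> f))) \<in> ?J"
      by (intro ring_ideal_sum ring_ideal_hull)
    moreover have "(\<Sum>f\<in>Poly_Mapping.keys p. Poly_Mapping.single f (Poly_Mapping.lookup p f)) = p"
      by (intro poly_mapping_eqI)
        (auto simp: lookup_sum lookup_single when_def not_in_keys_iff_lookup_eq_zero)
    ultimately show "p - ?p' \<in> ?J" by (simp add: sum_subtractf)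
  qed
qed

lemma reduced_in_lattice_ideal:
  assumes c: "partial_character c" and p: "p \<in> lattice_ideal c" and red: "reduced c p"
  shows "p = 0"
proof (rule ccontr)
  assume "p \<noteq> 0"
  then obtain u where u: "u \<in> Poly_Mapping.keys p" by fastforce
  have "linear_extension (\<lambda>f. c (f - u)) p =
      (\<Sum>f\<in>Poly_Mapping.keys p. if f = u then Poly_Mapping.lookup p u else 0)"
    unfolding linear_extension_def
    by (intro sum.cong) (use red u partial_character_0[OF c] in \<open>auto simp: reduced_def\<close>)
  also have "\<dots> = Poly_Mapping.lookup p u" using u by simp
  finally show False using p u by (simp add: lattice_ideal_def in_keys_iff)
qed

text \<open>An element of the lattice ideal has a reduced form in the same ideal, and a reduced element has no
  coset on which its terms could cancel; so the reduced form is \<open>0\<close>.\<close>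

lemma lattice_ideal_eq_hull:
  assumes c: "partial_character c"
  shows "lattice_ideal c = ring_ideal hull lattice_binomials c"
proof
  have "lattice_binomials c \<subseteq> lattice_ideal c"
    using binomial_in_lattice_ideal_iff[OF c] by (auto simp: lattice_binomials_def)
  then show sub: "ring_ideal hull lattice_binomials c \<subseteq> lattice_ideal c"
    by (intro hull_minimal ring_ideal_lattice_ideal)
  show "lattice_ideal c \<subseteq> ring_ideal hull lattice_binomials c"
  proof
    fix p assume p: "p \<in> lattice_ideal c"
    obtain p' where p': "p - p' \<in> ring_ideal hull lattice_binomials c" and red: "reduced c p'"
      by (rule reduce_mod_lattice[OF c])
    have "p' \<in> lattice_ideal c"
      using ring_ideal_diff[OF ring_ideal_lattice_ideal p, of "p - p'"] p' sub by auto
    then have "p' = 0" using reduced_in_lattice_ideal[OF c] red by blast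
    then show "p \<in> ring_ideal hull lattice_binomials c" using p' by simp
  qed
qed

lemma lattice_ideal_subset_iff:
  assumes c: "partial_character c" and J: "ring_ideal J"
  shows "lattice_ideal c \<subseteq> J \<longleftrightarrow> lattice_binomials c \<subseteq> J"
  unfolding lattice_ideal_eq_hull[OF c]
  using J by (meson hull_minimal hull_subset subset_trans)


section \<open>Lattice ideals of saturated lattices are prime\<close>

lemma of_nat_smult_closed:
  fixes f :: "int poly ^ 'n"
  assumes "\<And>u v. u \<in> P \<Longrightarrow> v \<in> P \<Longrightarrow> u + v \<in> P" "0 \<in> P" "f \<in> P"
  shows "(of_nat k :: int poly) *s f \<in> P"
  using assms by (induction k) (auto simp: vector_sadd_rdistrib)

text \<open>The quotient of \<open>\<int>[x]\<^sup>n\<close> by a saturated subgroup is torsion-free, so it carries a linear group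
  order; \<open>P\<close> is the set of elements that are nonnegative in this order. Zorn's lemma provides a maximal
  partial order, given by its cone \<open>P\<close>. If neither \<open>g\<close> nor \<open>- g\<close> were in \<open>P\<close>, adjoining \<open>g\<close> or \<open>- g\<close>
  would violate antisymmetry; this puts negative multiples of both \<open>g\<close> and \<open>- g\<close> in \<open>P\<close>, and thus a
  multiple of \<open>g\<close> in \<open>M\<close>, against saturation.\<close>

lemma saturated_total_preorder:
  fixes M :: "(int poly ^ 'n) set"
  assumes M0: "0 \<in> M" and Madd: "\<And>u v. u \<in> M \<Longrightarrow> v \<in> M \<Longrightarrow> u + v \<in> M"
    and sat: "Z_saturated M"
  obtains P where "M \<subseteq> P" "\<And>u v. u \<in> P \<Longrightarrow> v \<in> P \<Longrightarrow> u + v \<in> P"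
    "\<And>u. u \<in> P \<or> - u \<in> P" "\<And>u. u \<in> P \<Longrightarrow> - u \<in> P \<Longrightarrow> u \<in> M"
proof -
  define \<A> where "\<A> = {P. M \<subseteq> P \<and> (\<forall>u\<in>P. \<forall>v\<in>P. u + v \<in> P) \<and> (\<forall>u. u \<in> P \<longrightarrow> - u \<in> P \<longrightarrow> u \<in> M)}"
  have mem_\<A>: "P \<in> \<A> \<longleftrightarrow>
      M \<subseteq> P \<and> (\<forall>u\<in>P. \<forall>v\<in>P. u + v \<in> P) \<and> (\<forall>u. u \<in> P \<longrightarrow> - u \<in> P \<longrightarrow> u \<in> M)" for P
    by (simp add: \<A>_def)
  have "\<exists>P\<in>\<A>. \<forall>X\<in>\<A>. P \<subseteq> X \<longrightarrow> X = P"
  proof (rule subset_Zorn_nonempty)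
    have "M \<in> \<A>" using Madd by (simp add: mem_\<A>)
    then show "\<A> \<noteq> {}" by blast
  next
    fix \<C> assume ne: "\<C> \<noteq> {}" and ch: "subset.chain \<A> \<C>"
    have in_A: "J \<in> \<A>" if "J \<in> \<C>" for J
      using ch that by (auto simp: subset.chain_def)
    have common: "\<exists>K\<in>\<C>. u \<in> K \<and> v \<in> K" if "u \<in> \<Union>\<C>" "v \<in> \<Union>\<C>" for u v
    proof -
      obtain J J' where J: "J \<in> \<C>" "u \<in> J" "J' \<in> \<C>" "v \<in> J'" using \<open>u \<in> \<Union>\<C>\<close> \<open>v \<in> \<Union>\<C>\<close> by auto
      then have "J \<subseteq> J' \<or> J' \<subseteq> J" using ch by (auto simp: subset.chain_def)
      then show ?thesis using J by blast
    qed
    have "M \<subseteq> \<Union>\<C>" using ne in_A unfolding mem_\<A> by blast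
    moreover have "u + v \<in> \<Union>\<C>" if uv: "u \<in> \<Union>\<C>" "v \<in> \<Union>\<C>" for u v
    proof -
      obtain K where "K \<in> \<C>" "u \<in> K" "v \<in> K" using common uv by blast
      then show ?thesis using in_A[of K] by (auto simp: mem_\<A>)
    qed
    moreover have "u \<in> M" if uv: "u \<in> \<Union>\<C>" "- u \<in> \<Union>\<C>" for u
    proof -
      obtain K where "K \<in> \<C>" "u \<in> K" "- u \<in> K" using common uv by blast
      then show ?thesis using in_A[of K] by (auto simp: mem_\<A>)
    qed
    ultimately show "\<Union>\<C> \<in> \<A>" by (simp add: mem_\<A>)
  qed
  then obtain P where P: "P \<in> \<A>" and max: "\<And>X. X \<in> \<A> \<Longrightarrow> P \<subseteq> X \<Longrightarrow> X = P" by blast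
  have MP: "M \<subseteq> P" and Padd: "\<And>u v. u \<in> P \<Longrightarrow> v \<in> P \<Longrightarrow> u + v \<in> P"
    and PM: "\<And>u. u \<in> P \<Longrightarrow> - u \<in> P \<Longrightarrow> u \<in> M"
    using P by (auto simp: mem_\<A>)
  have P0: "0 \<in> P" using MP M0 by blast
  have neg_multiple: "\<exists>k\<ge>1. - ((of_nat k :: int poly) *s g) \<in> P" if g: "g \<notin> P" for g
  proof -
    \<comment> \<open>The cone generated by \<open>P\<close> and \<open>g\<close>.\<close>
    define X where "X = {p + (of_nat k :: int poly) *s g | p k. p \<in> P}"
    have PX: "P \<subseteq> X" by (force simp: X_def intro: exI[of _ 0])
    have gX: "g \<in> X" using P0 by (force simp: X_def intro: exI[of _ 0] exI[of _ 1])
    have Xadd: "u + v \<in> X" if uv: "u \<in> X" "v \<in> X" for u v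
    proof -
      obtain p k p' k' where "u = p + of_nat k *s g" "v = p' + of_nat k' *s g" "p \<in> P" "p' \<in> P"
        using uv by (auto simp: X_def)
      then have "u + v = (p + p') + of_nat (k + k') *s g" "p + p' \<in> P"
        using Padd by (auto simp: vector_sadd_rdistrib algebra_simps)
      then show ?thesis unfolding X_def by blast
    qed
    have "X \<notin> \<A>" using max[OF _ PX] gX g by blast
    then obtain h where hX: "h \<in> X" "- h \<in> X" and hM: "h \<notin> M"
      using order_trans[OF MP PX] Xadd unfolding mem_\<A> by blast
    obtain p k where h1: "h = p + of_nat k *s g" and p1: "p \<in> P" using hX(1) unfolding X_def by blast
    obtain p' k' where h2: "- h = p' + of_nat k' *s g" and p2: "p' \<in> P" using hX(2) unfolding X_def by blast
    note h = h1 h2 and p = p1 p2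
    have "of_nat (k + k') *s g = - (p + p')"
    proof -
      have "(p + p') + of_nat (k + k') *s g = h + - h"
        unfolding h2 by (simp add: h1 vector_sadd_rdistrib)
      then show ?thesis by (simp only: right_minus add_eq_0_iff)
    qed
    then have "- ((of_nat (k + k') :: int poly) *s g) \<in> P" using p Padd by simp
    moreover have "k + k' \<ge> 1"
    proof (rule ccontr)
      assume "\<not> k + k' \<ge> 1"
      then have "k = 0" "k' = 0" by auto
      then have "h \<in> P" "- h \<in> P" using p h2 by (auto simp: h1)
      then show False using PM hM by blast
    qed
    ultimately show ?thesis by blast
  qed
  have "g \<in> P \<or> - g \<in> P" for g
  proof (rule ccontr)
    assume "\<not> (g \<in> P \<or> - g \<in> P)"
    then obtain k l where k: "k \<ge> 1" "- ((of_nat k :: int poly) *s g) \<in> P"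
      and l: "l \<ge> 1" "(of_nat l :: int poly) *s g \<in> P"
      using neg_multiple[of g] neg_multiple[of "- g"] by (auto simp: vector_smult_rneg)
    have "of_nat l *s (- ((of_nat k :: int poly) *s g)) \<in> P"
      using Padd P0 k(2) by (rule of_nat_smult_closed)
    moreover have "of_nat k *s ((of_nat l :: int poly) *s g) \<in> P"
      using Padd P0 l(2) by (rule of_nat_smult_closed)
    ultimately have "(of_nat (k * l) :: int poly) *s g \<in> M"
      using PM[of "of_nat (k * l) *s g"]
      by (simp add: vector_smult_rneg vector_smult_assoc mult.commute)
    moreover have "k * l \<ge> 1" using k l by simp
    ultimately have "g \<in> M" using sat unfolding Z_saturated_def by blast
    then show False using MP \<open>\<not> (g \<in> P \<or> - g \<in> P)\<close> by blast
  qed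
  then show ?thesis using that MP Padd PM by blast
qed

text \<open>Here \<open>u \<le> a\<close> means \<open>a - u \<in> P\<close>.\<close>

lemma finite_has_greatest_in_total_preorder:
  fixes A :: "'g::ab_group_add set"
  assumes "finite A" "A \<noteq> {}"
    and "\<And>u v. u \<in> P \<Longrightarrow> v \<in> P \<Longrightarrow> u + v \<in> P" "\<And>u. u \<in> P \<or> - u \<in> P"
  shows "\<exists>a\<in>A. \<forall>u\<in>A. a - u \<in> P"
  using assms(1,2)
proof (induction A rule: finite_ne_induct)
  case (singleton x)
  then show ?case using assms(4)[of 0] by simp
next
  case (insert x A)
  then obtain a where a: "a \<in> A" "\<And>u. u \<in> A \<Longrightarrow> a - u \<in> P" by auto
  have 0: "0 \<in> P" using assms(4)[of 0] by simp
  show ?case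
  proof (cases "a - x \<in> P")
    case True
    then show ?thesis using a by auto
  next
    case False
    then have xa: "x - a \<in> P" using assms(4)[of "a - x"] by simp
    have "x - u \<in> P" if "u \<in> A" for u
      using assms(3)[OF xa a(2)[OF that]] by simp
    then show ?thesis using 0 by auto
  qed
qed

text \<open>The leading term argument for group algebras of ordered groups, applied to reduced representatives
  \<open>p'\<close> and \<open>q'\<close> of the factors: with leading exponents \<open>a\<close> and \<open>b\<close>, the product of the leading terms is
  the only contribution to the coset of \<open>a + b\<close>, so \<open>p' q'\<close> is not in the ideal.\<close>

lemma prime_lattice_ideal:
  fixes c :: "int poly ^ 'n \<Rightarrow> 'a::field"
  assumes c: "partial_character c" and sat: "Z_saturated {f. c f \<noteq> 0}"
  shows "prime_ideal (lattice_ideal c)"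
proof -
  let ?I = "lattice_ideal c"
  have I: "ring_ideal ?I" by (rule ring_ideal_lattice_ideal)
  have hull: "ring_ideal hull lattice_binomials c = ?I" using lattice_ideal_eq_hull[OF c] by simp
  obtain P where MP: "{f. c f \<noteq> 0} \<subseteq> P" and Padd: "\<And>u v. u \<in> P \<Longrightarrow> v \<in> P \<Longrightarrow> u + v \<in> P"
    and Ptot: "\<And>u. u \<in> P \<or> - u \<in> P" and PM: "\<And>u. u \<in> P \<Longrightarrow> - u \<in> P \<Longrightarrow> u \<in> {f. c f \<noteq> 0}"
  proof (rule saturated_total_preorder[OF _ _ sat])
    show "0 \<in> {f. c f \<noteq> 0}" using partial_character_0[OF c] by simp
    show "u + v \<in> {f. c f \<noteq> 0}" if "u \<in> {f. c f \<noteq> 0}" "v \<in> {f. c f \<noteq> 0}" for u v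
      using that partial_character_add[OF c, of u v] by simp
  qed blast
  have "p \<in> ?I \<or> q \<in> ?I" if pq: "p * q \<in> ?I" for p q
  proof (rule ccontr)
    assume *: "\<not> (p \<in> ?I \<or> q \<in> ?I)"
    obtain p' where p': "p - p' \<in> ?I" "reduced c p'"
      using reduce_mod_lattice[OF c, of p] unfolding hull by blast
    obtain q' where q': "q - q' \<in> ?I" "reduced c q'"
      using reduce_mod_lattice[OF c, of q] unfolding hull by blast
    have "p' \<noteq> 0" "q' \<noteq> 0" using * p' q' by auto
    then have ne: "Poly_Mapping.keys p' \<noteq> {}" "Poly_Mapping.keys q' \<noteq> {}" by auto
    obtain a where a: "a \<in> Poly_Mapping.keys p'" "\<And>u. u \<in> Poly_Mapping.keys p' \<Longrightarrow> a - u \<in> P"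
      using finite_has_greatest_in_total_preorder[OF finite_keys ne(1) Padd Ptot] by blast
    obtain b where b: "b \<in> Poly_Mapping.keys q'" "\<And>v. v \<in> Poly_Mapping.keys q' \<Longrightarrow> b - v \<in> P"
      using finite_has_greatest_in_total_preorder[OF finite_keys ne(2) Padd Ptot] by blast
    have lead: "u = a \<and> v = b"
      if uv: "u \<in> Poly_Mapping.keys p'" "v \<in> Poly_Mapping.keys q'" "c (u + v - (a + b)) \<noteq> 0" for u v
    proof -
      have m: "u + v - (a + b) \<in> P" using uv MP by auto
      have "(u + v - (a + b)) + (b - v) \<in> P" "(u + v - (a + b)) + (a - u) \<in> P"
        using Padd[OF m] a(2)[OF uv(1)] b(2)[OF uv(2)] by blast+
      then have "- (a - u) \<in> P" "- (b - v) \<in> P" by (simp_all add: algebra_simps)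
      then have "c (a - u) \<noteq> 0" "c (b - v) \<noteq> 0" using PM a b uv by auto
      then show ?thesis using a(1) b(1) uv p'(2) q'(2) unfolding reduced_def by blast
    qed
    have "p' * q' = p * q - (q * (p - p') + p' * (q - q'))" by (simp add: algebra_simps)
    moreover have "q * (p - p') + p' * (q - q') \<in> ?I"
      using I p'(1) q'(1) unfolding ring_ideal_def by blast
    ultimately have "p' * q' \<in> ?I" using ring_ideal_diff[OF I pq] by simp
    then have "0 = linear_extension (\<lambda>f. c (f - (a + b))) (p' * q')"
      by (simp add: lattice_ideal_def)
    also have "\<dots> = (\<Sum>u\<in>Poly_Mapping.keys p'. \<Sum>v\<in>Poly_Mapping.keys q'.
        if u = a then if v = b then Poly_Mapping.lookup p' a * Poly_Mapping.lookup q' b else 0 else 0)"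
      unfolding linear_extension_mult
      by (intro sum.cong) (use lead partial_character_0[OF c] in auto)
    also have "\<dots> = Poly_Mapping.lookup p' a * Poly_Mapping.lookup q' b"
    proof -
      have "(\<Sum>v\<in>Poly_Mapping.keys q'. if u = a then if v = b then t else 0 else 0)
        = (if u = a then t else 0)" for u and t :: 'a
        using b(1) by simp
      then show ?thesis using a(1) by simp
    qed
    finally show False using a(1) b(1) by (simp add: in_keys_iff)
  qed
  moreover have "?I \<noteq> UNIV" using one_notin_lattice_ideal[OF c] by auto
  ultimately show ?thesis using I by (simp add: prime_ideal_def)
qed


section \<open>The difference operator\<close>

lemma difference_field_hom:
  assumes "difference_field \<sigma>"
  shows "\<sigma> 0 = 0" "\<sigma> 1 = 1" "\<sigma> (a + b) = \<sigma> a + \<sigma> b" "\<sigma> (a * b) = \<sigma> a * \<sigma> b" "\<sigma> a = 0 \<longleftrightarrow> a = 0"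
  using assms by (auto simp: difference_field_def ring_endomorphism_def)

lemma lsigma_add:
  assumes "difference_field \<sigma>"
  shows "lsigma \<sigma> (p + q) = lsigma \<sigma> p + lsigma \<sigma> q"
  unfolding lsigma_def using assms
  by (intro setsum_keys_plus_distrib) (auto simp: difference_field_hom single_add)

lemma lsigma_diff:
  assumes "difference_field \<sigma>"
  shows "lsigma \<sigma> (p - q) = lsigma \<sigma> p - lsigma \<sigma> q"
  using lsigma_add[OF assms, of "p - q" q] by simp

lemma lsigma_mult:
  assumes \<sigma>: "difference_field \<sigma>"
  shows "lsigma \<sigma> (p * q) = lsigma \<sigma> p * lsigma \<sigma> q"
proof (induction p rule: poly_mapping_add_induct)
  case (single f a)
  show ?case
    by (induction q rule: poly_mapping_add_induct)
      (auto simp: lsigma_lterm lsigma_add difference_field_hom[OF \<sigma>] \<sigma> mult_single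
        vector_add_ldistrib distrib_left)
qed (simp add: lsigma_add[OF \<sigma>] distrib_right)

lemma lsigma_0: "lsigma \<sigma> 0 = 0"
  by (simp add: lsigma_def)

lemma lsigma_1:
  assumes "difference_field \<sigma>"
  shows "lsigma \<sigma> 1 = 1"
proof -
  have "lsigma \<sigma> (lconst 1) = lconst 1"
    using assms by (simp only: lsigma_lterm difference_field_hom vector_smult_rzero)
  then show ?thesis by (simp only: single_one)
qed

lemma lsigma_power: "difference_field \<sigma> \<Longrightarrow> lsigma \<sigma> (p ^ k) = lsigma \<sigma> p ^ k"
  by (induction k) (auto simp: lsigma_1 lsigma_mult)

text \<open>Since the ideal is generated by its binomials, it suffices to see that \<open>\<sigma>\<close> maps these into it.\<close>

lemma sigma_ideal_lattice_ideal:
  fixes c :: "int poly ^ 'n::finite \<Rightarrow> 'a::field"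
  assumes \<sigma>: "difference_field \<sigma>" and c: "partial_character c"
    and compat: "\<And>f. c f \<noteq> 0 \<Longrightarrow> c ([:0, 1:] *s f) = \<sigma> (c f)"
  shows "sigma_ideal (lsigma \<sigma>) (lattice_ideal c)"
proof -
  let ?I = "lattice_ideal c"
  have I: "ring_ideal ?I" by (rule ring_ideal_lattice_ideal)
  have "ring_ideal {p. lsigma \<sigma> p \<in> ?I}"
    using I by (auto simp: ring_ideal_def lsigma_0 lsigma_add[OF \<sigma>] lsigma_mult[OF \<sigma>])
  moreover have "lattice_binomials c \<subseteq> {p. lsigma \<sigma> p \<in> ?I}"
    using binomial_in_lattice_ideal_iff[OF c] compat
    by (auto simp: lattice_binomials_def lsigma_diff[OF \<sigma>] lsigma_lterm difference_field_hom[OF \<sigma>]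
        simp del: single_one)
  ultimately have "?I \<subseteq> {p. lsigma \<sigma> p \<in> ?I}"
    using lattice_ideal_subset_iff[OF c] by blast
  then show ?thesis using I by (auto simp: sigma_ideal_def)
qed

text \<open>Saturation makes the exponents \<open>x f\<close> and \<open>x g\<close> congruent only if \<open>f\<close> and \<open>g\<close> are. Hence no new
  cancellation can occur in \<open>\<sigma> p\<close>: what it leaves on the coset of \<open>x g\<close> is the image under \<open>\<sigma>\<close> of what
  \<open>p\<close> leaves on the coset of \<open>g\<close>.\<close>

lemma reflexive_lattice_ideal:
  fixes c :: "int poly ^ 'n::finite \<Rightarrow> 'a::field"
  assumes \<sigma>: "difference_field \<sigma>"
    and compat: "\<And>f. c f \<noteq> 0 \<Longrightarrow> c ([:0, 1:] *s f) = \<sigma> (c f)"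
    and sat: "x_saturated {f. c f \<noteq> 0}" and p: "lsigma \<sigma> p \<in> lattice_ideal c"
  shows "p \<in> lattice_ideal c"
proof -
  have c: "c ([:0, 1:] *s f) = \<sigma> (c f)" for f
    using sat compat[of f] difference_field_hom(1)[OF \<sigma>]
    by (cases "c f = 0") (auto simp: x_saturated_def)
  have lin: "linear_extension (\<lambda>f. c (f - [:0, 1:] *s g)) (lsigma \<sigma> q)
      = \<sigma> (linear_extension (\<lambda>f. c (f - g)) q)" for q g
    by (induction q rule: poly_mapping_add_induct)
      (auto simp: lsigma_lterm lsigma_add[OF \<sigma>] difference_field_hom[OF \<sigma>]
        vector_ssub_ldistrib[symmetric] c)
  have "\<sigma> (linear_extension (\<lambda>f. c (f - g)) p) = 0" for g
    unfolding lin[symmetric] using p by (simp add: lattice_ideal_def)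
  then show ?thesis by (simp add: lattice_ideal_def difference_field_hom[OF \<sigma>])
qed


section \<open>The partial character of an ideal\<close>

text \<open>A proper ideal contains no nonzero constant, so it contains \<open>Y\<^sup>f - a\<close> for at most one \<open>a\<close>.\<close>

definition ideal_character :: "('g::ab_group_add \<Rightarrow>\<^sub>0 'a::field) set \<Rightarrow> 'g \<Rightarrow> 'a" where
  "ideal_character J f =
     (if \<exists>a. a \<noteq> 0 \<and> Poly_Mapping.single f 1 - Poly_Mapping.single 0 a \<in> J
      then THE a. a \<noteq> 0 \<and> Poly_Mapping.single f 1 - Poly_Mapping.single 0 a \<in> J else 0)"

lemma single_in_proper_ideal:
  fixes J :: "('g::ab_group_add \<Rightarrow>\<^sub>0 'a::field) set"
  assumes J: "ring_ideal J" "1 \<notin> J" and f: "Poly_Mapping.single f a \<in> J"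
  shows "a = 0"
proof (rule ccontr)
  assume "a \<noteq> 0"
  have "Poly_Mapping.single (- f) (inverse a) * Poly_Mapping.single f a \<in> J"
    using J f by (auto simp: ring_ideal_def)
  then show False using J \<open>a \<noteq> 0\<close> by (simp add: mult_single)
qed

lemma ideal_character_eq_iff:
  assumes J: "ring_ideal J" "1 \<notin> J" and a: "a \<noteq> 0"
  shows "ideal_character J f = a \<longleftrightarrow> Poly_Mapping.single f 1 - Poly_Mapping.single 0 a \<in> J"
proof -
  have unique: "a = b" if ab: "Poly_Mapping.single f 1 - Poly_Mapping.single 0 a \<in> J"
      "Poly_Mapping.single f 1 - Poly_Mapping.single 0 b \<in> J" for a b
  proof -
    have "Poly_Mapping.single 0 (b - a) \<in> J"
      using ring_ideal_diff[OF J(1) ab] by (simp add: single_diff)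
    then show ?thesis using single_in_proper_ideal[OF J] by fastforce
  qed
  have the: "(THE b. b \<noteq> 0 \<and> Poly_Mapping.single f 1 - Poly_Mapping.single 0 b \<in> J) = b"
    if "b \<noteq> 0" "Poly_Mapping.single f 1 - Poly_Mapping.single 0 b \<in> J" for b
    using that unique by (intro the_equality) auto
  show ?thesis
  proof
    assume "ideal_character J f = a"
    with a obtain b where b: "b \<noteq> 0" "Poly_Mapping.single f 1 - Poly_Mapping.single 0 b \<in> J"
      by (auto simp: ideal_character_def split: if_splits)
    then have "b = a" using \<open>ideal_character J f = a\<close> the[OF b] by (auto simp: ideal_character_def)
    then show "Poly_Mapping.single f 1 - Poly_Mapping.single 0 a \<in> J" using b by simp
  next
    assume "Poly_Mapping.single f 1 - Poly_Mapping.single 0 a \<in> J"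
    then show "ideal_character J f = a" using a the by (auto simp: ideal_character_def)
  qed
qed

lemma binomial_mult_iff:
  fixes J :: "('g::ab_group_add \<Rightarrow>\<^sub>0 'a::field) set"
  assumes J: "ring_ideal J" and a: "a \<noteq> 0"
    and m: "Poly_Mapping.single m 1 - Poly_Mapping.single 0 a \<in> J"
  shows "Poly_Mapping.single (m + f) 1 - Poly_Mapping.single 0 (a * b) \<in> J \<longleftrightarrow>
    Poly_Mapping.single f 1 - Poly_Mapping.single 0 b \<in> J" (is "?s \<in> J \<longleftrightarrow> ?t \<in> J")
proof -
  let ?u = "Poly_Mapping.single f 1 * (Poly_Mapping.single m 1 - Poly_Mapping.single 0 a)"
  have u: "?u \<in> J" using J m by (auto simp: ring_ideal_def)
  have s: "?s = ?u + Poly_Mapping.single 0 a * ?t"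
    by (simp add: algebra_simps mult_single)
  have t: "?t = Poly_Mapping.single 0 (inverse a) * (?s - ?u)"
    using a by (simp add: right_diff_distrib mult_single mult.commute[of "Poly_Mapping.single f 1"]
        mult.assoc[symmetric] add.commute)
  show ?thesis
  proof
    assume "?s \<in> J"
    then have "Poly_Mapping.single 0 (inverse a) * (?s - ?u) \<in> J"
      using J ring_ideal_diff[OF J _ u] by (auto simp: ring_ideal_def)
    then show "?t \<in> J" using t by simp
  next
    assume "?t \<in> J"
    then have "?u + Poly_Mapping.single 0 a * ?t \<in> J" using J u by (auto simp: ring_ideal_def)
    then show "?s \<in> J" using s by simp
  qed
qed

lemma partial_character_ideal_character:
  fixes J :: "('g::ab_group_add \<Rightarrow>\<^sub>0 'a::field) set"
  assumes J: "ring_ideal J" "1 \<notin> J"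
  shows "partial_character (ideal_character J)"
  unfolding partial_character_def
proof (intro conjI allI impI)
  have "0 \<in> J" using J by (simp add: ring_ideal_def)
  then show "ideal_character J 0 = 1" by (subst ideal_character_eq_iff[OF J]) auto
  fix m f assume m: "ideal_character J m \<noteq> 0"
  let ?c = "ideal_character J"
  have "Poly_Mapping.single m 1 - Poly_Mapping.single 0 (?c m) \<in> J"
    using ideal_character_eq_iff[OF J m, of m] by simp
  note iff = binomial_mult_iff[OF J(1) m this, of f]
  show "?c (m + f) = ?c m * ?c f"
  proof (cases "?c f = 0")
    case False
    then show ?thesis
      using m iff[of "?c f"] ideal_character_eq_iff[OF J, of "?c m * ?c f" "m + f"]
        ideal_character_eq_iff[OF J False, of f] by simp
  next
    case True
    have "?c (m + f) = 0"
    proof (rule ccontr)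
      assume *: "?c (m + f) \<noteq> 0"
      let ?b = "?c (m + f) / ?c m"
      have "Poly_Mapping.single f 1 - Poly_Mapping.single 0 ?b \<in> J"
        using iff[of ?b] m ideal_character_eq_iff[OF J *, of "m + f"] by simp
      then have "?c f = ?b" using ideal_character_eq_iff[OF J, of ?b f] * m by simp
      then show False using True * m by simp
    qed
    then show ?thesis using True by simp
  qed
qed

lemma support_lattice_eq_support:
  assumes J: "ring_ideal J" "1 \<notin> J"
  shows "support_lattice J = {f. ideal_character J f \<noteq> 0}"
proof -
  have "(\<exists>a. a \<noteq> 0 \<and> lmonom f - lconst a \<in> J) \<longleftrightarrow> ideal_character J f \<noteq> 0" for f
    by (metis ideal_character_eq_iff[OF J])
  then show ?thesis by (simp add: support_lattice_def)
qed

lemma ideal_character_smult_x: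
  assumes \<sigma>: "difference_field \<sigma>" and J: "sigma_ideal (lsigma \<sigma>) J" "1 \<notin> J"
    and f: "ideal_character J f \<noteq> 0"
  shows "ideal_character J ([:0, 1:] *s f) = \<sigma> (ideal_character J f)"
proof -
  have J': "ring_ideal J" using J by (simp add: sigma_ideal_def)
  have "lmonom f - lconst (ideal_character J f) \<in> J"
    using ideal_character_eq_iff[OF J' J(2) f] by blast
  then have "lsigma \<sigma> (lmonom f - lconst (ideal_character J f)) \<in> J"
    using J by (auto simp: sigma_ideal_def)
  then show ?thesis
    using ideal_character_eq_iff[OF J' J(2)] f
    by (simp add: lsigma_diff[OF \<sigma>] lsigma_lterm difference_field_hom[OF \<sigma>] del: single_one)
qed

text \<open>Monomials are units. In a proper ideal a generator with one nonzero coefficient is therefore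
  impossible, and one with two is a unit times a binomial \<open>Y\<^sup>f - a\<close>.\<close>

lemma laurent_binomial_ideal_eq_lattice_ideal:
  assumes \<sigma>: "difference_field \<sigma>" and I: "laurent_binomial_ideal \<sigma> I" "1 \<notin> I"
  shows "I = lattice_ideal (ideal_character I)"
proof -
  let ?c = "ideal_character I"
  obtain S where S: "S \<subseteq> {lterm a g + lterm b h | a b g h. True}" "I = sigma_ideal_gen (lsigma \<sigma>) S"
    using I by (auto simp: laurent_binomial_ideal_def)
  have sI: "sigma_ideal (lsigma \<sigma>) I" unfolding S(2) by (rule sigma_ideal_sigma_ideal_gen)
  then have rI: "ring_ideal I" by (simp add: sigma_ideal_def)
  have c: "partial_character ?c" by (rule partial_character_ideal_character[OF rI I(2)])
  have sL: "sigma_ideal (lsigma \<sigma>) (lattice_ideal ?c)"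
    by (rule sigma_ideal_lattice_ideal[OF \<sigma> c ideal_character_smult_x[OF \<sigma> sI I(2)]])
  have "lattice_binomials ?c \<subseteq> I"
    using ideal_character_eq_iff[OF rI I(2)] by (auto simp: lattice_binomials_def)
  then have "lattice_ideal ?c \<subseteq> I" using lattice_ideal_subset_iff[OF c rI] by simp
  moreover have "S \<subseteq> lattice_ideal ?c"
  proof
    fix s assume "s \<in> S"
    then obtain a b g h where s: "s = lterm a g + lterm b h" using S(1) by blast
    have sI: "s \<in> I" using \<open>s \<in> S\<close> unfolding S(2) sigma_ideal_gen_def by (rule hull_inc)
    have 0: "0 \<in> lattice_ideal ?c" using ring_ideal_lattice_ideal by (auto simp: ring_ideal_def)
    show "s \<in> lattice_ideal ?c"
    proof (cases "a = 0 \<or> b = 0")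
      case True
      then have "s = 0" using s sI single_in_proper_ideal[OF rI I(2)] by fastforce
      then show ?thesis using 0 by simp
    next
      case False
      let ?t = "lmonom (g - h) - lconst (- b / a)"
      have s': "s = lterm a h * ?t"
        using False s by (simp add: distrib_left mult_single single_uminus)
      have "?t = lterm (inverse a) (- h) * s"
        using False s by (simp add: distrib_left mult_single single_uminus divide_inverse mult.commute)
      then have "?t \<in> I" using sI rI by (simp only: ring_ideal_def)
      then have "?c (g - h) = - b / a"
        using ideal_character_eq_iff[OF rI I(2), of "- b / a"] False by simp
      then have "?t \<in> lattice_ideal ?c"
        using binomial_in_lattice_ideal_iff[OF c, of "- b / a"] False by simp
      then show ?thesis
        using ring_ideal_lattice_ideal[of ?c] unfolding s' by (simp only: ring_ideal_def)
    qed
  qed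
  then have "I \<subseteq> lattice_ideal ?c"
    unfolding S(2) sigma_ideal_gen_def using sL[unfolded S(2) sigma_ideal_gen_def]
    by (rule hull_minimal)
  ultimately show ?thesis by blast
qed


section \<open>Binomials and roots of unity\<close>

lemma single_power:
  fixes f :: "int poly ^ 'n"
  shows "Poly_Mapping.single f (a::'a::comm_ring_1) ^ k = Poly_Mapping.single (of_nat k *s f) (a ^ k)"
  by (induction k) (simp_all add: mult_single vector_sadd_rdistrib)

lemma lconst_root_of_unity:
  fixes w :: "'a::field"
  assumes w: "primitive_root_of_unity k w"
  shows "(lconst w :: ('a, 'n::finite) laurent) ^ k = 1"
    and "0 < m \<Longrightarrow> m < k \<Longrightarrow> (\<Sum>j<k. (lconst w :: ('a, 'n) laurent) ^ (m * j)) = 0"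
proof -
  show "(lconst w :: ('a, 'n) laurent) ^ k = 1"
    using w by (simp add: single_power primitive_root_of_unity_def)
  have "(\<Sum>j<n. lconst (h j)) = (lconst (\<Sum>j<n. h j) :: ('a, 'n) laurent)" for n :: nat and h
    by (induction n) (simp_all add: single_add)
  then show "(\<Sum>j<k. (lconst w :: ('a, 'n) laurent) ^ (m * j)) = 0" if "0 < m" "m < k"
    using primitive_root_sum_powers[OF w that] by (simp add: single_power)
qed

lemma of_nat_mult_in_ideal_cancel:
  fixes J :: "('a::field_char_0, 'n::finite) laurent set"
  assumes J: "ring_ideal J" and k: "k \<noteq> 0" and q: "of_nat k * q \<in> J"
  shows "q \<in> J"
proof -
  have "lconst (inverse (of_nat k)) * (of_nat k * q) \<in> J" using J q by (auto simp: ring_ideal_def)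
  moreover have "(lconst (inverse (of_nat k)) :: ('a, 'n) laurent) * of_nat k = 1"
    using k by (simp add: mult_single flip: single_of_nat)
  ultimately show ?thesis by (simp add: mult.assoc[symmetric])
qed

text \<open>Dividing \<open>Y\<^sup>f\<close> by a \<open>k\<close>-th root of the character value turns it into a \<open>k\<close>-th root of unity modulo
  the ideal.\<close>

lemma normalized_power_binomial:
  fixes J :: "('a::field, 'n::finite) laurent set"
  assumes J: "ring_ideal J" and "a \<noteq> 0"
    and "lmonom (of_nat k *s f) - lconst (a ^ k) \<in> J"
  shows "lterm (inverse a) f ^ k - 1 \<in> J"
proof -
  have "lconst (inverse a ^ k) * (lmonom (of_nat k *s f) - lconst (a ^ k)) \<in> J"
    using assms by (auto simp: ring_ideal_def)
  then show ?thesis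
    using assms(2) by (simp add: single_power right_diff_distrib mult_single flip: power_mult_distrib)
qed

text \<open>For \<open>k f\<close> in the support, \<open>Y\<^sup>f\<close> becomes a \<open>k\<close>-th root of unity \<open>z\<close> after scaling, and the product of
  all \<open>z - \<omega>\<^sup>j\<close> is in \<open>J\<close>. If no factor were in \<open>J\<close>, then \<open>r\<close> would lie in \<open>J\<close> on every component.
  The last assumption covers two kinds of ideals: prime ideals, with \<open>r = 1\<close>, and ideals that are
  maximal among those avoiding \<open>r\<close>.\<close>

lemma Z_saturated_support_lattice:
  fixes J :: "('a::{alg_closed_field, field_char_0}, 'n::finite) laurent set"
  assumes \<zeta>: "\<And>k. k \<ge> 2 \<Longrightarrow> primitive_root_of_unity k (\<zeta> k :: 'a)"
    and J: "ring_ideal J" and r: "r \<notin> J"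
    and res: "\<And>t u. t * u \<in> J \<Longrightarrow> t \<notin> J \<Longrightarrow> r * u \<in> J"
  shows "Z_saturated (support_lattice J)"
  unfolding Z_saturated_def
proof (intro allI impI)
  fix k :: nat and f :: "int poly ^ 'n"
  assume k: "1 \<le> k" and kf: "of_nat k *s f \<in> support_lattice J"
  show "f \<in> support_lattice J"
  proof (cases "k = 1")
    case False
    with k have k2: "k \<ge> 2" by simp
    obtain b where b: "b \<noteq> 0" "lmonom (of_nat k *s f) - lconst b \<in> J"
      using kf by (auto simp: support_lattice_def)
    obtain a where a: "a ^ k = b" using nth_root_exists[of k b] k by auto
    then have a0: "a \<noteq> 0" using b k by (auto simp: power_0_left)
    define z where "z = lterm (inverse a) f"
    define \<omega> :: "('a, 'n) laurent" where "\<omega> = lconst (\<zeta> k)"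
    have \<omega>: "\<omega> ^ k = 1" "\<And>m. 0 < m \<Longrightarrow> m < k \<Longrightarrow> (\<Sum>j<k. \<omega> ^ (m * j)) = 0"
      using lconst_root_of_unity[OF \<zeta>[OF k2]] by (auto simp: \<omega>_def)
    have z: "z ^ k - 1 \<in> J"
      unfolding z_def using normalized_power_binomial[OF J a0] b a by blast
    have "\<exists>j. z - \<omega> ^ j \<in> J"
    proof (rule ccontr)
      assume *: "\<nexists>j. z - \<omega> ^ j \<in> J"
      have "r * cofactor z \<omega> k j \<in> J" for j
        using res[of "z - \<omega> ^ j" "cofactor z \<omega> k j"] z * diff_times_cofactor[OF \<omega>(1), of z j] by simp
      then have "of_nat k * r \<in> J" by (intro of_nat_mult_in_ideal_if_cofactors[OF J \<omega>])
      then show False using of_nat_mult_in_ideal_cancel[OF J, of k r] k r by simp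
    qed
    then obtain j where "z - \<omega> ^ j \<in> J" by blast
    then have "lconst a * (z - \<omega> ^ j) \<in> J" using J by (auto simp: ring_ideal_def)
    then have "lmonom f - lconst (a * \<zeta> k ^ j) \<in> J"
      using a0 by (simp add: z_def \<omega>_def right_diff_distrib mult_single single_power)
    moreover have "\<zeta> k \<noteq> 0"
      using \<zeta>[OF k2] by (auto simp: primitive_root_of_unity_def power_0_left)
    ultimately show ?thesis
      using a0 by (auto simp: support_lattice_def intro!: exI[of _ "a * \<zeta> k ^ j"])
  qed (use kf in simp)
qed

lemma well_mixed_binomial:
  fixes J :: "('a::field_char_0, 'n::finite) laurent set"
  assumes \<sigma>: "difference_field \<sigma>" and J: "well_mixed (lsigma \<sigma>) J"
    and w: "primitive_root_of_unity k w" "\<sigma> w = w ^ e" and a: "a \<noteq> 0"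
    and kf: "lmonom (of_nat k *s f) - lconst (a ^ k) \<in> J"
  shows "lmonom (([:0, 1:] - of_nat e) *s f) - lconst (\<sigma> a / a ^ e) \<in> J"
proof -
  have J': "ring_ideal J" using J by (simp add: well_mixed_def sigma_ideal_def)
  note hom = difference_field_hom[OF \<sigma>]
  let ?z = "lterm (inverse a) f"
  have "\<sigma> (inverse a) * \<sigma> a = 1" using a by (simp flip: hom(4) add: hom)
  then have inv: "\<sigma> a * \<sigma> (inverse a) = 1" by (simp add: mult.commute)
  have "of_nat k * (lsigma \<sigma> ?z - ?z ^ e) \<in> J"
  proof (rule well_mixed_root_of_unity[OF J lsigma_diff[OF \<sigma>] lsigma_power[OF \<sigma>]
        lconst_root_of_unity[OF w(1)]])
    show "lsigma \<sigma> (lconst w) = lconst w ^ e"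
      by (simp add: lsigma_lterm hom w(2) single_power)
    show "?z ^ k - 1 \<in> J" by (rule normalized_power_binomial[OF J' a kf])
  qed
  then have "lsigma \<sigma> ?z - ?z ^ e \<in> J"
    using of_nat_mult_in_ideal_cancel[OF J'] w(1) by (auto simp: primitive_root_of_unity_def)
  then have "lterm (\<sigma> a) (- (of_nat e *s f)) * (lsigma \<sigma> ?z - ?z ^ e) \<in> J"
    using J' by (auto simp: ring_ideal_def)
  moreover have "lterm (\<sigma> a) (- (of_nat e *s f)) * (lsigma \<sigma> ?z - ?z ^ e)
      = lmonom (([:0, 1:] - of_nat e) *s f) - lconst (\<sigma> a / a ^ e)"
    using inv by (simp add: lsigma_lterm hom single_power right_diff_distrib mult_single
        vector_sub_rdistrib divide_inverse power_inverse)
  ultimately show ?thesis by simp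
qed

lemma transforming_degree_root:
  assumes "difference_field \<sigma>" "k \<ge> 2" "primitive_root_of_unity k (\<zeta> k)"
  shows "\<sigma> (\<zeta> k) = \<zeta> k ^ transforming_degree \<sigma> \<zeta> k"
  using theI'[OF transforming_degree_unique[OF assms(1,3)]] assms(2)
  by (simp add: transforming_degree_def)


section \<open>Prime difference ideals above a binomial ideal\<close>

lemma partial_character_of_nat_smult:
  fixes c :: "int poly ^ 'n \<Rightarrow> 'a::field"
  assumes c: "partial_character c" and f: "c f \<noteq> 0"
  shows "c (of_nat k *s f) = c f ^ k"
proof (induction k)
  case 0
  then show ?case using partial_character_0[OF c] by simp
next
  case (Suc k)
  then show ?case using partial_character_add[OF c f, of "of_nat k *s f"]
    by (simp add: vector_sadd_rdistrib)
qed

lemma partial_character_restrict: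
  assumes c: "partial_character c" and "0 \<in> H" "\<And>m f. m \<in> H \<Longrightarrow> m + f \<in> H \<longleftrightarrow> f \<in> H"
  shows "partial_character (\<lambda>f. if f \<in> H then c f else 0)"
  using assms by (auto simp: partial_character_def)

text \<open>The prime ideal is a lattice ideal with character \<open>e\<close> on the saturation \<open>H\<close> of the support lattice.
  An ideal \<open>J\<close> that is maximal among those avoiding \<open>r\<close> has a saturated support, and \<open>e\<close> is its character
  cut down to \<open>H\<close>; this keeps saturation, hence primality, and avoids \<open>r\<close>.

  The restriction to \<open>H\<close> is what makes the ideal closed under \<open>\<sigma>\<close>. For \<open>f \<in> H\<close> some \<open>k f\<close> is in the
  support lattice, and M-saturation determines \<open>e\<close> on \<open>x f\<close> by \<open>e f\<close> and the value of the given character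
  on \<open>(x - o\<^sub>k) f\<close>. The well-mixed ideal \<open>W\<close> contains a binomial with this exponent for which the outcome
  is \<open>\<sigma> (e f)\<close>; as \<open>W\<close> is proper, it has no other binomial with the same exponent.\<close>

lemma prime_sigma_ideal_avoiding:
  fixes I :: "('a::{alg_closed_field, field_char_0}, 'n::finite) laurent set"
  assumes \<sigma>: "difference_field \<sigma>"
    and \<zeta>: "\<And>k. k \<ge> 2 \<Longrightarrow> primitive_root_of_unity k (\<zeta> k)"
    and I: "laurent_binomial_ideal \<sigma> I" "sigma_ideal (lsigma \<sigma>) I"
    and W: "well_mixed (lsigma \<sigma>) W" "I \<subseteq> W" "1 \<notin> W"
    and M: "M_saturated \<sigma> \<zeta> (support_lattice I)"
    and r: "r \<notin> I"
  obtains K where "prime_sigma_ideal (lsigma \<sigma>) K" "I \<subseteq> K" "r \<notin> K"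
proof -
  have I1: "1 \<notin> I" using W by blast
  have rI: "ring_ideal I" using I by (simp add: sigma_ideal_def)
  have rW: "ring_ideal W" using W by (simp add: well_mixed_def sigma_ideal_def)
  obtain J where J: "ring_ideal J" "I \<subseteq> J" "r \<notin> J" and max: "\<forall>t. t \<notin> J \<longrightarrow> (\<exists>v. r - v * t \<in> J)"
    by (rule maximal_ideal_avoiding[OF rI r])
  have J1: "1 \<notin> J" using J ring_ideal_eq_UNIV_iff[OF J(1)] by auto
  let ?c = "ideal_character I" and ?d = "ideal_character J"
  have c: "partial_character ?c" by (rule partial_character_ideal_character[OF rI I1])
  have d: "partial_character ?d" by (rule partial_character_ideal_character[OF J(1) J1])
  have mono: "ideal_character X f = ?c f"
    if "?c f \<noteq> 0" "ring_ideal X" "1 \<notin> X" "I \<subseteq> X" for X f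
    using ideal_character_eq_iff[OF rI I1 that(1), of f] ideal_character_eq_iff[OF that(2,3,1), of f] that(4)
    by auto
  have L: "support_lattice I = {f. ?c f \<noteq> 0}" by (rule support_lattice_eq_support[OF rI I1])
  have "Z_saturated (support_lattice J)"
  proof (rule Z_saturated_support_lattice[OF \<zeta> J(1,3)])
    fix t u assume tu: "t * u \<in> J" "t \<notin> J"
    obtain v where "r - v * t \<in> J" using max tu by blast
    then have "u * (r - v * t) + v * (t * u) \<in> J" using J(1) tu by (auto simp: ring_ideal_def)
    then show "r * u \<in> J" by (simp add: algebra_simps)
  qed
  then have satJ: "Z_saturated {f. ?d f \<noteq> 0}"
    by (simp add: support_lattice_eq_support[OF J(1) J1])
  \<comment> \<open>The saturation of the support; it is a subgroup, as one sees by passing to common multiples.\<close>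
  define H where "H = {f. \<exists>k\<ge>1. ?c (of_nat k *s f) \<noteq> 0}"
  have multiple: "?c (of_nat (k * l) *s f) \<noteq> 0" if "?c (of_nat k *s f) \<noteq> 0" for k l f
    using partial_character_of_nat_smult[OF c that, of l] that
    by (simp add: vector_smult_assoc mult.commute)
  have H_add: "m + f \<in> H \<longleftrightarrow> f \<in> H" if m: "m \<in> H" for m f
  proof -
    obtain k where k: "k \<ge> 1" "?c (of_nat k *s m) \<noteq> 0" using m by (auto simp: H_def)
    have eq: "?c (of_nat (k * l) *s (m + f)) = ?c (of_nat (k * l) *s m) * ?c (of_nat (k * l) *s f)" for l
      using partial_character_add[OF c multiple[OF k(2)], of l] by (simp add: vector_add_ldistrib)
    show ?thesis
    proof
      assume "m + f \<in> H"
      then obtain l where l: "l \<ge> 1" "?c (of_nat l *s (m + f)) \<noteq> 0" by (auto simp: H_def)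
      have "?c (of_nat (k * l) *s f) \<noteq> 0"
        using eq[of l] multiple[OF l(2), of k] by (auto simp: mult.commute)
      moreover have "k * l \<ge> 1" using k l by simp
      ultimately show "f \<in> H" unfolding H_def by blast
    next
      assume "f \<in> H"
      then obtain l where l: "l \<ge> 1" "?c (of_nat l *s f) \<noteq> 0" by (auto simp: H_def)
      have "?c (of_nat (k * l) *s (m + f)) \<noteq> 0"
        using eq[of l] multiple[OF l(2), of k] multiple[OF k(2), of l] by (auto simp: mult.commute)
      moreover have "k * l \<ge> 1" using k l by simp
      ultimately show "m + f \<in> H" unfolding H_def by blast
    qed
  qed
  have LH: "f \<in> H" if "?c f \<noteq> 0" for f
    unfolding H_def using that by (auto intro!: exI[of _ 1])
  define e where "e f = (if f \<in> H then ?d f else 0)" for f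
  have e: "partial_character e"
    unfolding e_def using H_add LH partial_character_0[OF c] by (intro partial_character_restrict d) auto
  have ec: "e f = ?c f" if "?c f \<noteq> 0" for f
    using LH[OF that] mono[OF that J(1) J1 J(2)] by (simp add: e_def)
  have sat: "Z_saturated {f. e f \<noteq> 0}"
    unfolding Z_saturated_def
  proof (intro allI impI)
    fix k :: nat and f :: "int poly ^ 'n"
    assume k: "k \<ge> 1" and "of_nat k *s f \<in> {f. e f \<noteq> 0}"
    then have kf: "of_nat k *s f \<in> H" "?d (of_nat k *s f) \<noteq> 0" by (auto simp: e_def split: if_splits)
    obtain l where l: "l \<ge> 1" "?c (of_nat l *s (of_nat k *s f)) \<noteq> 0" using kf by (auto simp: H_def)
    then have "?c (of_nat (l * k) *s f) \<noteq> 0" by (simp add: vector_smult_assoc)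
    moreover have "l * k \<ge> 1" using k l by simp
    ultimately have "f \<in> H" unfolding H_def by blast
    moreover have "?d f \<noteq> 0" using satJ k kf(2) by (auto simp: Z_saturated_def)
    ultimately show "f \<in> {f. e f \<noteq> 0}" by (simp add: e_def)
  qed
  have compat: "e ([:0, 1:] *s f) = \<sigma> (e f)" if f: "e f \<noteq> 0" for f
  proof -
    have fH: "f \<in> H" and ef: "e f = ?d f" using f by (auto simp: e_def split: if_splits)
    obtain l where l: "l \<ge> 1" "?c (of_nat l *s f) \<noteq> 0" using fH by (auto simp: H_def)
    \<comment> \<open>Doubling ensures \<open>k \<ge> 2\<close>, where \<open>\<zeta> k\<close> is known to be a primitive root.\<close>
    define k where "k = l * 2"
    have k: "k \<ge> 2" and kf: "?c (of_nat k *s f) \<noteq> 0"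
      using l multiple[OF l(2), of 2] by (auto simp: k_def)
    let ?a = "e f" and ?o = "transforming_degree \<sigma> \<zeta> k"
    have "?c (of_nat k *s f) = ?a ^ k"
      using ec[OF kf] partial_character_of_nat_smult[OF e f] by simp
    then have kfI: "lmonom (of_nat k *s f) - lconst (?a ^ k) \<in> I"
      using f by (subst ideal_character_eq_iff[OF rI I1, symmetric]) simp_all
    have "lmonom (([:0, 1:] - of_nat ?o) *s f) - lconst (\<sigma> ?a / ?a ^ ?o) \<in> W"
      by (rule well_mixed_binomial[OF \<sigma> W(1) \<zeta>[OF k]
            transforming_degree_root[where \<zeta> = \<zeta>, OF \<sigma> k \<zeta>[OF k]] f
            subsetD[OF W(2) kfI]])
    then have "ideal_character W (([:0, 1:] - of_nat ?o) *s f) = \<sigma> ?a / ?a ^ ?o"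
      using ideal_character_eq_iff[OF rW W(3)] f difference_field_hom(5)[OF \<sigma>] by simp
    moreover have nz: "?c (([:0, 1:] - of_nat ?o) *s f) \<noteq> 0"
      using M kf k unfolding L M_saturated_def by auto
    ultimately have "e (([:0, 1:] - of_nat ?o) *s f) = \<sigma> ?a / ?a ^ ?o"
      using mono[OF nz rW W(3,2)] ec[OF nz] by simp
    moreover have "[:0, 1:] *s f = ([:0, 1:] - of_nat ?o) *s f + of_nat ?o *s f"
      by (simp add: vector_sub_rdistrib)
    ultimately have "e ([:0, 1:] *s f) = \<sigma> ?a / ?a ^ ?o * e (of_nat ?o *s f)"
      using partial_character_add[OF e, of "([:0, 1:] - of_nat ?o) *s f"] ec[OF nz] nz by metis
    then show ?thesis using partial_character_of_nat_smult[OF e f, of ?o] f by simp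
  qed
  show ?thesis
  proof
    show "prime_sigma_ideal (lsigma \<sigma>) (lattice_ideal e)"
      unfolding prime_sigma_ideal_def
      using prime_lattice_ideal[OF e sat] sigma_ideal_lattice_ideal[OF \<sigma> e compat] by blast
    have "lattice_binomials ?c \<subseteq> lattice_ideal e"
      using binomial_in_lattice_ideal_iff[OF e] ec by (auto simp: lattice_binomials_def)
    then have "lattice_ideal ?c \<subseteq> lattice_ideal e"
      using lattice_ideal_subset_iff[OF c ring_ideal_lattice_ideal] by blast
    then show "I \<subseteq> lattice_ideal e"
      using laurent_binomial_ideal_eq_lattice_ideal[OF \<sigma> I(1) I1] by simp
    have "lattice_binomials e \<subseteq> J"
      using ideal_character_eq_iff[OF J(1) J1] by (auto simp: lattice_binomials_def e_def)
    then show "r \<notin> lattice_ideal e" using lattice_ideal_subset_iff[OF e J(1)] J(3) by blast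
  qed
qed


section \<open>Perfect difference ideals\<close>

text \<open>Take \<open>a = x\<close> in the definition.\<close>

lemma perfect_reflexive:
  assumes "perfect s J"
  shows "reflexive_sigma_ideal s J"
proof -
  have "p \<in> J" if "s p \<in> J" for p
  proof -
    have "diff_power s p [:0, 1:] \<in> J" using that by (simp add: diff_power_def)
    moreover have "[:0, 1:] \<noteq> (0 :: nat poly)" by simp
    ultimately show ?thesis using assms unfolding perfect_def by blast
  qed
  then show ?thesis using assms by (simp add: perfect_def reflexive_sigma_ideal_def)
qed

text \<open>Take \<open>a = 1 + x\<close>: the element \<open>p \<sigma>(q)\<close> times its image contains the factor \<open>\<sigma>(p q)\<close>.\<close>

lemma perfect_well_mixed:
  assumes J: "perfect s J" and mult: "\<And>p q. s (p * q) = s p * s q"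
  shows "well_mixed s J"
proof -
  have "p * s q \<in> J" if pq: "p * q \<in> J" for p q
  proof -
    have "s (p * q) \<in> J" using J pq by (auto simp: perfect_def sigma_ideal_def)
    then have "(p * s (s q)) * s (p * q) \<in> J"
      using J by (auto simp: perfect_def sigma_ideal_def ring_ideal_def)
    then have "diff_power s (p * s q) [:1, 1:] \<in> J"
      by (simp add: diff_power_def mult mult_ac)
    moreover have "[:1, 1:] \<noteq> (0 :: nat poly)" by simp
    ultimately show ?thesis using J unfolding perfect_def by blast
  qed
  then show ?thesis using J by (simp add: perfect_def well_mixed_def)
qed

lemma prime_ideal_prod:
  assumes K: "prime_ideal K" and "finite A" "prod h A \<in> K"
  shows "\<exists>i\<in>A. h i \<in> K"
  using assms(2,3)
proof (induction A rule: finite_induct)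
  case empty
  then show ?case using K ring_ideal_eq_UNIV_iff[of K] by (auto simp: prime_ideal_def)
next
  case (insert x A)
  then show ?case using K by (auto simp: prime_ideal_def)
qed

lemma prime_ideal_power:
  assumes K: "prime_ideal K" and "p ^ n \<in> K"
  shows "p \<in> K"
  using prime_ideal_prod[OF K, of "{..<n}" "\<lambda>_. p"] assms(2) by auto

text \<open>Some factor \<open>\<sigma>\<^sup>i(p)\<close> with \<open>i \<le> degree a\<close> is in \<open>K\<close>. Applying \<open>\<sigma>\<close> further reaches the exponent
  \<open>degree a\<close>, which depends on \<open>a\<close> only and so serves for all primes \<open>K\<close> alike.\<close>

lemma prime_sigma_ideal_diff_power:
  assumes K: "prime_sigma_ideal s K" and a: "diff_power s p a \<in> K"
  shows "(s ^^ degree a) p \<in> K"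
proof -
  have K': "prime_ideal K" and closed: "\<And>q. q \<in> K \<Longrightarrow> s q \<in> K"
    using K by (auto simp: prime_sigma_ideal_def sigma_ideal_def)
  obtain i where i: "i \<le> degree a" "(s ^^ i) p ^ coeff a i \<in> K"
    using prime_ideal_prod[OF K' _ a[unfolded diff_power_def]] by auto
  then have "(s ^^ i) p \<in> K" using prime_ideal_power[OF K'] by blast
  then have "(s ^^ j) ((s ^^ i) p) \<in> K" for j
    by (induction j) (auto intro: closed)
  from this[of "degree a - i"] show ?thesis
    using i by (simp flip: funpow_add[unfolded comp_def, THEN fun_cong] add: funpow_add[symmetric])
qed


section \<open>Binomial difference ideals and their support lattices\<close>

theorem theorem1p2:
  fixes \<sigma> :: "'a::{alg_closed_field, field_char_0} \<Rightarrow> 'a"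
    and \<zeta> :: "nat \<Rightarrow> 'a"
    and I :: "('a, 'n::finite) laurent set"
    and L :: "(int poly ^ 'n) set"
  assumes "inversive_difference_field \<sigma>"
    and "\<forall>k\<ge>2. primitive_root_of_unity k (\<zeta> k)"
    and "laurent_binomial_ideal \<sigma> I"
    and "I \<noteq> sigma_ideal_gen (lsigma \<sigma>) {1}"
    and "L = support_lattice I"
  shows "(prime_sigma_ideal (lsigma \<sigma>) I \<longleftrightarrow> Z_saturated L) \<and>
    (reflexive_sigma_ideal (lsigma \<sigma>) I \<longleftrightarrow> x_saturated L) \<and>
    (well_mixed_closure (lsigma \<sigma>) I \<noteq> sigma_ideal_gen (lsigma \<sigma>) {1} \<longrightarrow>
       (well_mixed (lsigma \<sigma>) I \<longleftrightarrow> M_saturated \<sigma> \<zeta> L)) \<and>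
    (perfect_closure (lsigma \<sigma>) I \<noteq> sigma_ideal_gen (lsigma \<sigma>) {1} \<longrightarrow>
       (perfect (lsigma \<sigma>) I \<longleftrightarrow> M_saturated \<sigma> \<zeta> L \<and> x_saturated L))"
proof -
  let ?s = "lsigma \<sigma> :: ('a, 'n) laurent \<Rightarrow> ('a, 'n) laurent"
  have \<sigma>: "difference_field \<sigma>" and "surj \<sigma>"
    using assms(1) by (auto simp: inversive_difference_field_def bij_is_surj)
  note hom = difference_field_hom[OF \<sigma>]
  have \<zeta>: "primitive_root_of_unity k (\<zeta> k)" if "k \<ge> 2" for k using assms(2) that by blast
  have sI: "sigma_ideal ?s I"
    using assms(3) sigma_ideal_sigma_ideal_gen by (auto simp: laurent_binomial_ideal_def)
  have rI: "ring_ideal I" using sI by (simp add: sigma_ideal_def)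
  have I1: "1 \<notin> I" using assms(4) ring_ideal_eq_UNIV_iff[OF rI] by (simp add: sigma_ideal_gen_1)
  let ?c = "ideal_character I"
  have c: "partial_character ?c" by (rule partial_character_ideal_character[OF rI I1])
  have I: "I = lattice_ideal ?c" by (rule laurent_binomial_ideal_eq_lattice_ideal[OF \<sigma> assms(3) I1])
  have L: "L = {f. ?c f \<noteq> 0}" using support_lattice_eq_support[OF rI I1] assms(5) by simp
  have compat: "?c ([:0, 1:] *s f) = \<sigma> (?c f)" if "?c f \<noteq> 0" for f
    by (rule ideal_character_smult_x[OF \<sigma> sI I1 that])
  have mem: "lmonom f - lconst (?c f) \<in> I" if "f \<in> L" for f
    using ideal_character_eq_iff[OF rI I1] that L by blast
  have memL: "f \<in> L" if "lmonom f - lconst a \<in> I" "a \<noteq> 0" for f a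
    using that assms(5) by (auto simp: support_lattice_def)

  have prime: "prime_sigma_ideal ?s I \<longleftrightarrow> Z_saturated L"
  proof
    assume "prime_sigma_ideal ?s I"
    then have "1 * u \<in> I" if "t * u \<in> I" "t \<notin> I" for t u
      using that by (auto simp: prime_sigma_ideal_def prime_ideal_def)
    then show "Z_saturated L"
      unfolding assms(5) using \<zeta> rI I1 by (intro Z_saturated_support_lattice[where r = 1])
  next
    assume "Z_saturated L"
    then have "prime_ideal I" using prime_lattice_ideal[OF c] I L by simp
    then show "prime_sigma_ideal ?s I" using sI by (simp add: prime_sigma_ideal_def)
  qed

  have reflexive: "reflexive_sigma_ideal ?s I \<longleftrightarrow> x_saturated L"
  proof
    assume refl: "reflexive_sigma_ideal ?s I"
    show "x_saturated L"
      unfolding x_saturated_def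
    proof (intro allI impI)
      fix f assume xf: "[:0, 1:] *s f \<in> L"
      \<comment> \<open>This is where \<open>\<sigma>\<close> has to be surjective.\<close>
      obtain a where a: "\<sigma> a = ?c ([:0, 1:] *s f)" using \<open>surj \<sigma>\<close> by (metis surjD)
      have "?s (lmonom f - lconst a) \<in> I"
        using mem[OF xf] a by (simp add: lsigma_diff[OF \<sigma>] lsigma_lterm hom)
      then have "lmonom f - lconst a \<in> I" using refl by (auto simp: reflexive_sigma_ideal_def)
      moreover have "a \<noteq> 0" using a xf L hom(1) by auto
      ultimately show "f \<in> L" by (rule memL)
    qed
  next
    assume "x_saturated L"
    then have "p \<in> I" if "?s p \<in> I" for p
      using reflexive_lattice_ideal[where c = ?c, OF \<sigma> compat] that I L by blast
    then show "reflexive_sigma_ideal ?s I" using sI by (simp add: reflexive_sigma_ideal_def)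
  qed

  have M_if_well_mixed: "M_saturated \<sigma> \<zeta> L" if wm: "well_mixed ?s I"
    unfolding M_saturated_def
  proof (intro allI impI)
    fix k :: nat and f assume k: "1 \<le> k" and kf: "of_nat k *s f \<in> L"
    show "([:0, 1:] - of_nat (transforming_degree \<sigma> \<zeta> k)) *s f \<in> L"
    proof (cases "k = 1")
      case True
      then show ?thesis using kf L compat[of f] hom by (simp add: transforming_degree_def)
    next
      case False
      with k have k2: "k \<ge> 2" by simp
      obtain a where a: "a ^ k = ?c (of_nat k *s f)" using nth_root_exists[of k] k by auto
      then have a0: "a \<noteq> 0" using kf k L by (auto simp: power_0_left)
      have "lmonom (([:0, 1:] - of_nat (transforming_degree \<sigma> \<zeta> k)) *s f)
          - lconst (\<sigma> a / a ^ transforming_degree \<sigma> \<zeta> k) \<in> I"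
        using mem[OF kf] a
        by (intro well_mixed_binomial[OF \<sigma> wm \<zeta>[OF k2]
              transforming_degree_root[where \<zeta> = \<zeta>, OF \<sigma> k2 \<zeta>[OF k2]] a0]) simp
      then show ?thesis by (rule memL) (use a0 hom in simp)
    qed
  qed

  have W1: "1 \<notin> well_mixed_closure ?s I" if "well_mixed_closure ?s I \<noteq> sigma_ideal_gen ?s {1}"
    using that well_mixed_well_mixed_closure[of ?s I] ring_ideal_eq_UNIV_iff[of "well_mixed_closure ?s I"]
    by (simp add: sigma_ideal_gen_1 well_mixed_def sigma_ideal_def)
  have avoid: "\<exists>K. prime_sigma_ideal ?s K \<and> I \<subseteq> K \<and> r \<notin> K"
    if "1 \<notin> well_mixed_closure ?s I" "M_saturated \<sigma> \<zeta> L" "r \<notin> I" for r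
    using prime_sigma_ideal_avoiding[OF \<sigma> \<zeta> assms(3) sI well_mixed_well_mixed_closure _ that(1)
        that(2)[unfolded assms(5)] that(3)]
    by (metis hull_subset well_mixed_closure_def)
  \<comment> \<open>By \<open>avoid\<close>, \<open>I\<close> is an intersection of prime difference ideals, and these are well-mixed.\<close>
  have well_mixed_if_M: "well_mixed ?s I"
    if W: "1 \<notin> well_mixed_closure ?s I" and M: "M_saturated \<sigma> \<zeta> L"
  proof -
    have "p * ?s q \<in> I" if pq: "p * q \<in> I" for p q
    proof (rule ccontr)
      assume "p * ?s q \<notin> I"
      then obtain K where K: "prime_sigma_ideal ?s K" "I \<subseteq> K" "p * ?s q \<notin> K"
        using avoid[OF W M] by blast
      then have "p \<in> K \<or> ?s q \<in> K"
        using pq by (auto simp: prime_sigma_ideal_def prime_ideal_def sigma_ideal_def)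
      then have "?s q * p \<in> K \<or> p * ?s q \<in> K"
        using K(1) by (auto simp: prime_sigma_ideal_def sigma_ideal_def ring_ideal_def)
      then show False using K(3) by (simp add: mult.commute)
    qed
    then show ?thesis using sI by (simp add: well_mixed_def)
  qed

  have perfect: "perfect ?s I \<longleftrightarrow> M_saturated \<sigma> \<zeta> L \<and> x_saturated L"
    if P: "perfect_closure ?s I \<noteq> sigma_ideal_gen ?s {1}"
  proof
    assume "perfect ?s I"
    then show "M_saturated \<sigma> \<zeta> L \<and> x_saturated L"
      using M_if_well_mixed perfect_well_mixed[OF _ lsigma_mult[OF \<sigma>]] perfect_reflexive reflexive by blast
  next
    assume sat: "M_saturated \<sigma> \<zeta> L \<and> x_saturated L"
    have pP: "perfect ?s (perfect_closure ?s I)" by (rule perfect_perfect_closure)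
    have "I \<subseteq> perfect_closure ?s I" unfolding perfect_closure_def by (rule hull_subset)
    then have "well_mixed_closure ?s I \<subseteq> perfect_closure ?s I"
      unfolding well_mixed_closure_def using perfect_well_mixed[OF pP lsigma_mult[OF \<sigma>]]
      by (rule hull_minimal)
    moreover have "1 \<notin> perfect_closure ?s I"
      using P pP ring_ideal_eq_UNIV_iff[of "perfect_closure ?s I"]
      by (simp add: sigma_ideal_gen_1 perfect_def sigma_ideal_def)
    ultimately have W: "1 \<notin> well_mixed_closure ?s I" by blast
    have refl: "\<And>p. ?s p \<in> I \<Longrightarrow> p \<in> I" using sat reflexive by (auto simp: reflexive_sigma_ideal_def)
    have refl_iterate: "(?s ^^ n) p \<in> I \<Longrightarrow> p \<in> I" for n p
      by (induction n) (auto intro: refl)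
    have "p \<in> I" if a: "diff_power ?s p a \<in> I" for p a
    proof -
      \<comment> \<open>Reflexivity of \<open>I\<close> reduces the claim to this iterate, which every prime difference ideal above \<open>I\<close> contains.\<close>
      have "(?s ^^ degree a) p \<in> I"
      proof (rule ccontr)
        assume "(?s ^^ degree a) p \<notin> I"
        then obtain K where "prime_sigma_ideal ?s K" "I \<subseteq> K" "(?s ^^ degree a) p \<notin> K"
          using avoid[OF W] sat by blast
        then show False using prime_sigma_ideal_diff_power[of ?s K p a] a by blast
      qed
      then show "p \<in> I" by (rule refl_iterate)
    qed
    then show "perfect ?s I" using sI unfolding perfect_def by blast
  qed

  show ?thesis using prime reflexive M_if_well_mixed well_mixed_if_M W1 perfect by blast
qed

end
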